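(* In a translationally invariant 1D local Gaussian fermion channel (brick-wall circuit with one-period momentum-space data $(A_k,B_k)$), the correlation functions between dissipative modes decay exponentially in the steady state in the thermodynamic limit. That is, with $\Gamma^{(\mathrm s)}_{k,d}$ the dissipative steady-state correlation matrix at momentum $k$ (extended by $0$ on the preserved subspace $V_{k,u}$) and $G(x)=\int_{-\pi}^{\pi}\frac{dk}{2\pi}\,e^{ikx}\,\Gamma^{(\mathrm s)}_{k,d}$ for $x\in\mathbb{Z}$, there exist constants $C,\xi>0$ such that $\lVert G(x)\rVert\le C e^{-|x|/\xi}$ for all $x\in\mathbb{Z}$.
   Context: **Setting.** Each site of a ring hosts $n$ Majorana modes; a unit cell consists of two sites ($2n$ modes), and $x$ labels unit cells. A Gaussian fermion channel acts on real antisymmetric correlation matrices ($\Gamma\Gamma^T\le I$) by $\Gamma\mapsto \mathsf A+\mathsf B\Gamma \mathsf B^T$, with $\mathsf A$ real antisymmetric, $\mathsf B$ real, and the CPTP condition $\Lambda^T\Lambda\le I$ for $\Lambda=\begin{pmatrix}\mathsf A&\mathsf B\\ -\mathsf B^T&0\end{pmatrix}$. In odd time steps a two-site channel $(\mathsf A_o,\mathsf B_o)$ ($2n\times2n$ matrices) acts on the two sites of every unit cell; in even time steps a two-site channel $(\mathsf A_e,\mathsf B_e)$ acts on every pair formed by the second site of a cell and the first site of the next one. **Momentum space.** With $U_k=\begin{pmatrix}0&I_n\\ e^{-ik}I_n&0\end{pmatrix}$, one period (two steps) acts on the momentum-space correlation matrix $\Gamma_k$ ($2n\times2n$, $\Gamma_k^\dagger=-\Gamma_k$,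 $\Gamma_k\Gamma_k^\dagger\le I$) by $\Gamma_k\mapsto A_k+B_k\Gamma_kB_k^\dagger$, where $B_k=U_k\mathsf B_eU_k^\dagger\,\mathsf B_o$ and $A_k=U_k\mathsf A_eU_k^\dagger+U_k\mathsf B_eU_k^\dagger\,\mathsf A_o\,U_k\mathsf B_e^TU_k^\dagger$. These are trigonometric polynomials in $k$ and satisfy $A_k^\dagger A_k+B_kB_k^\dagger\le I$ and $B_k^\dagger B_k\le I$ for real $k$. In the thermodynamic limit $k$ ranges over $\mathbb{R}/2\pi\mathbb{Z}$ and real-space correlations are given by the Fourier integral over $k$. **Preserved and dissipative modes.** $V_{k,u}\subset\mathbb{C}^{2n}$ is the span of the eigenvectors of $B_k$ with eigenvalues of modulus $1$, $V_{k,d}=V_{k,u}^\perp$, and $P_{k,d}$ is the orthogonal projector onto $V_{k,d}$, which commutes with $A_k$ and $B_k$. The restriction of $B_k$ to $V_{k,d}$ has spectral radius less than $1$. $\Gamma^{(\mathrm s)}_{k,d}$ is the unique operator on $V_{k,d}$ solving $\Gamma^{(\mathrm s)}_{k,d}=P_{k,d}A_k+P_{k,d}B_k\,\Gamma^{(\mathrm s)}_{k,d}\,B_k^\dagger P_{k,d}$; it is the long-time limit of the correlation matrix restricted to the dissipative subspace. *)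

theory Defs
  imports "HOL-Analysis.Analysis"
begin

text \<open>
  The index type \<open>'n\<close> labels the Majorana modes of one site, so a unit cell (two sites) is
  labelled by \<open>'n + 'n\<close>, with \<open>Inl\<close> for the first and \<open>Inr\<close> for the second site.
\<close>

definition block_matrix ::
  "'a^'p^'m \<Rightarrow> 'a^'q^'m \<Rightarrow> 'a^'p^'l \<Rightarrow> 'a^'q^'l \<Rightarrow> 'a^('p::finite + 'q::finite)^('m::finite + 'l::finite)"
  where "block_matrix M11 M12 M21 M22 =
    (\<chi> i j. case i of
        Inl a \<Rightarrow> (case j of Inl b \<Rightarrow> M11 $ a $ b | Inr b \<Rightarrow> M12 $ a $ b)
      | Inr a \<Rightarrow> (case j of Inl b \<Rightarrow> M21 $ a $ b | Inr b \<Rightarrow> M22 $ a $ b))"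

definition hermitian_adjoint :: "complex^'p::finite^'m::finite \<Rightarrow> complex^'m^'p"
  where "hermitian_adjoint M = map_matrix cnj (transpose M)"

definition cinner :: "complex^'m::finite \<Rightarrow> complex^'m \<Rightarrow> complex"
  where "cinner u v = (\<Sum>i\<in>UNIV. cnj (u $ i) * v $ i)"

definition loewner_le :: "real^'m::finite^'m \<Rightarrow> real^'m^'m \<Rightarrow> bool"
  where "loewner_le X Y \<longleftrightarrow> transpose (Y - X) = Y - X \<and> (\<forall>v. 0 \<le> v \<bullet> ((Y - X) *v v))"

definition channel_matrix :: "real^'m::finite^'m \<Rightarrow> real^'m^'m \<Rightarrow> real^('m + 'm)^('m + 'm)"
  where "channel_matrix A B = block_matrix A B (- transpose B) 0"

text \<open>Complete positivity and trace preservation of \<open>\<Gamma> \<mapsto> A + B \<Gamma> B\<^sup>T\<close> amount to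
  \<open>\<Lambda>\<^sup>T \<Lambda> \<le> I\<close> in the Loewner order.\<close>

definition gaussian_channel :: "real^'m::finite^'m \<Rightarrow> real^'m^'m \<Rightarrow> bool"
  where "gaussian_channel A B \<longleftrightarrow>
    transpose A = - A \<and>
    loewner_le (transpose (channel_matrix A B) ** channel_matrix A B) (mat 1)"

definition shift_matrix :: "real \<Rightarrow> complex^('n::finite + 'n)^('n + 'n)"
  where "shift_matrix k = block_matrix 0 (mat 1) (mat (exp (- \<i> * of_real k))) 0"

definition momentum_even :: "real^('n::finite + 'n)^('n + 'n) \<Rightarrow> real \<Rightarrow> complex^('n + 'n)^('n + 'n)"
  where "momentum_even M k =
    shift_matrix k ** map_matrix of_real M ** hermitian_adjoint (shift_matrix k)"

text \<open>Arguments are always ordered as \<open>Ao Bo Ae Be\<close>: first the channel of the odd time step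
  (inside a unit cell), then the one of the even time step (across neighbouring cells).\<close>

definition period_B ::
  "real^('n::finite + 'n)^('n + 'n) \<Rightarrow> real^('n + 'n)^('n + 'n) \<Rightarrow> real \<Rightarrow> complex^('n + 'n)^('n + 'n)"
  where "period_B Bo Be k = momentum_even Be k ** map_matrix of_real Bo"

definition period_A ::
  "real^('n::finite + 'n)^('n + 'n) \<Rightarrow> real^('n + 'n)^('n + 'n) \<Rightarrow> real^('n + 'n)^('n + 'n)
    \<Rightarrow> real \<Rightarrow> complex^('n + 'n)^('n + 'n)"
  where "period_A Ao Ae Be k =
    momentum_even Ae k
    + momentum_even Be k ** map_matrix of_real Ao ** momentum_even (transpose Be) k"

definition preserved_space :: "complex^'m::finite^'m \<Rightarrow> (complex^'m) set"
  where "preserved_space B =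
    vec.span {v. v \<noteq> 0 \<and> (\<exists>z. norm z = 1 \<and> B *v v = z *s v)}"

definition dissipative_space :: "complex^'m::finite^'m \<Rightarrow> (complex^'m) set"
  where "dissipative_space B = {v. \<forall>u\<in>preserved_space B. cinner u v = 0}"

definition orthogonal_projector :: "(complex^'m::finite) set \<Rightarrow> complex^'m^'m"
  where "orthogonal_projector W =
    (THE P. P ** P = P \<and> hermitian_adjoint P = P \<and> range ((*v) P) = W)"

text \<open>An operator on the dissipative space is represented by its extension by zero to the whole
  space, which is what \<open>P ** X = X\<close> and \<open>X ** P = X\<close> express.\<close>

definition is_dissipative_steady_state ::
  "complex^'m::finite^'m \<Rightarrow> complex^'m^'m \<Rightarrow> complex^'m^'m \<Rightarrow> bool"
  where "is_dissipative_steady_state A B X \<longleftrightarrow>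
    (let P = orthogonal_projector (dissipative_space B) in
      P ** X = X \<and> X ** P = X \<and>
      X = P ** A + P ** B ** X ** hermitian_adjoint B ** P)"

text \<open>The solution is unique because the spectral radius of \<open>B\<close> on the dissipative space is
  less than \<open>1\<close>.\<close>

definition dissipative_steady_state :: "complex^'m::finite^'m \<Rightarrow> complex^'m^'m \<Rightarrow> complex^'m^'m"
  where "dissipative_steady_state A B = (THE X. is_dissipative_steady_state A B X)"

definition steady_state_momentum ::
  "real^('n::finite + 'n)^('n + 'n) \<Rightarrow> real^('n + 'n)^('n + 'n) \<Rightarrow> real^('n + 'n)^('n + 'n)
    \<Rightarrow> real^('n + 'n)^('n + 'n) \<Rightarrow> real \<Rightarrow> complex^('n + 'n)^('n + 'n)"
  where "steady_state_momentum Ao Bo Ae Be k =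
    dissipative_steady_state (period_A Ao Ae Be k) (period_B Bo Be k)"

definition correlation_integrand ::
  "real^('n::finite + 'n)^('n + 'n) \<Rightarrow> real^('n + 'n)^('n + 'n) \<Rightarrow> real^('n + 'n)^('n + 'n)
    \<Rightarrow> real^('n + 'n)^('n + 'n) \<Rightarrow> int \<Rightarrow> real \<Rightarrow> complex^('n + 'n)^('n + 'n)"
  where "correlation_integrand Ao Bo Ae Be x k =
    map_matrix (\<lambda>z. exp (\<i> * of_real k * of_int x) / of_real (2 * pi) * z)
      (steady_state_momentum Ao Bo Ae Be k)"

definition correlation ::
  "real^('n::finite + 'n)^('n + 'n) \<Rightarrow> real^('n + 'n)^('n + 'n) \<Rightarrow> real^('n + 'n)^('n + 'n)
    \<Rightarrow> real^('n + 'n)^('n + 'n) \<Rightarrow> int \<Rightarrow> complex^('n + 'n)^('n + 'n)"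
  where "correlation Ao Bo Ae Be x =
    set_lebesgue_integral lborel {-pi..pi} (correlation_integrand Ao Bo Ae Be x)"

end

theory Submission
  imports
    Defs
    "HOL-Computational_Algebra.Fundamental_Theorem_Algebra"
    "HOL-Complex_Analysis.Cauchy_Integral_Theorem"
begin

text \<open>
  For \<open>0 \<le> r < 1\<close> the damped equation \<open>X = A\<^sub>k + r B\<^sub>k X B\<^sub>k\<^sup>\<dagger>\<close> on the whole space has a unique
  solution \<open>X\<^sub>r(k)\<close>, a contraction whose entries are, by Cramer's rule, rational functions of \<open>r\<close>
  and \<open>e\<^sup>i\<^sup>k\<close>. The projector never has to be followed in \<open>k\<close>, because \<open>A\<^sub>k\<close> vanishes on the
  preserved modes: \<open>A\<^sub>k \<plusminus> B\<^sub>k B\<^sub>k\<^sup>\<dagger>\<close> are contractions and \<open>B\<^sub>k B\<^sub>k\<^sup>\<dagger>\<close> is the identity there. Hence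
  \<open>X\<^sub>r(k)\<close> lives on the dissipative modes, and as soon as its limit for \<open>r \<rightarrow> 1\<close> exists, this limit
  is the dissipative steady state. After division by powers of \<open>r - 1\<close> the limit exists for
  all but finitely many \<open>e\<^sup>i\<^sup>k\<close> and is a rational function of \<open>e\<^sup>i\<^sup>k\<close>. Being bounded by \<open>1\<close>, it has
  no poles on the unit circle, so it is holomorphic in an annulus around the circle and
  shifting the contour gives the exponential decay. The values at exceptional momenta, where the
  dimension of the dissipative space may jump, do not affect the integral.
\<close>

subsection \<open>Adjoints and contractions\<close>

lemma cinner_adjoint: "cinner (hermitian_adjoint M *v u) v = cinner u (M *v v)"
proof -
  have "cinner u (M *v v) = (\<Sum>i\<in>UNIV. \<Sum>j\<in>UNIV. cnj (u $ i) * (M $ i $ j * v $ j))"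
    by (simp add: cinner_def matrix_vector_mult_def sum_distrib_left)
  also have "\<dots> = (\<Sum>j\<in>UNIV. \<Sum>i\<in>UNIV. cnj (u $ i) * (M $ i $ j * v $ j))"
    by (rule sum.swap)
  also have "\<dots> = cinner (hermitian_adjoint M *v u) v"
    by (simp add: cinner_def matrix_vector_mult_def hermitian_adjoint_def transpose_def
        sum_distrib_left sum_distrib_right mult_ac)
  finally show ?thesis by simp
qed

lemma inner_eq_Re_cinner: "u \<bullet> v = Re (cinner u v)" for u v :: "complex^'m"
  by (simp add: inner_vec_def cinner_def inner_complex_def)

lemma cinner_scale_right: "cinner u (c *s v) = c * cinner u v"
  by (simp add: cinner_def sum_distrib_left mult_ac)

lemma cinner_add_right: "cinner u (v + w) = cinner u v + cinner u w"
  by (simp add: cinner_def sum.distrib algebra_simps)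

lemma cinner_zero_right [simp]: "cinner u 0 = 0"
  by (simp add: cinner_def)

lemma cinner_commute: "cinner u v = cnj (cinner v u)"
  by (simp add: cinner_def mult_ac)

lemma cinner_self_eq_0D: "cinner u u = 0 \<Longrightarrow> u = 0"
  using inner_eq_Re_cinner[of u u] by simp

text \<open>Bridge to the real inner product: pairing with \<open>\<i> *s v\<close> captures the
  imaginary part.\<close>

lemma cinner_eq_0_iff: "cinner u v = 0 \<longleftrightarrow> u \<bullet> v = 0 \<and> u \<bullet> (\<i> *s v) = 0"
  by (simp add: inner_eq_Re_cinner cinner_scale_right complex_eq_iff)

lemma inner_adjoint: "(hermitian_adjoint M *v u) \<bullet> v = u \<bullet> (M *v v)"
  by (simp add: inner_eq_Re_cinner cinner_adjoint)

lemma hermitian_adjoint_involutive [simp]: "hermitian_adjoint (hermitian_adjoint M) = M"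
  by (simp add: hermitian_adjoint_def vec_eq_iff transpose_def)

lemma hermitian_adjoint_mult:
  "hermitian_adjoint (M ** N) = hermitian_adjoint N ** hermitian_adjoint M"
  by (simp add: hermitian_adjoint_def vec_eq_iff transpose_def matrix_matrix_mult_def mult_ac)

lemma norm_smult_vec: "norm (c *s v) = norm c * norm v" for v :: "complex^'m"
  by (simp add: norm_vec_def norm_mult L2_set_right_distrib)

lemma scaleR_matrix_vector: "(r *\<^sub>R M) *v v = r *\<^sub>R (M *v v)" for M :: "complex^'n^'m"
  by (simp add: matrix_vector_mult_def vec_eq_iff scaleR_sum_right)

definition contraction :: "complex^'n::finite^'m::finite \<Rightarrow> bool"
  where "contraction M \<longleftrightarrow> (\<forall>v. norm (M *v v) \<le> norm v)"

lemma contraction_0 [simp]: "contraction 0"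
  by (simp add: contraction_def)

lemma contraction_mult: "contraction M \<Longrightarrow> contraction N \<Longrightarrow> contraction (M ** N)"
  unfolding contraction_def matrix_vector_mul_assoc[symmetric] using order_trans by blast

lemma contraction_scaleR:
  assumes "contraction M" "0 \<le> r" "r \<le> 1"
  shows "contraction (r *\<^sub>R M)"
  unfolding contraction_def
proof
  fix v
  have "norm (M *v v) \<le> norm v" using assms(1) by (simp add: contraction_def)
  then have "r * norm (M *v v) \<le> 1 * norm v"
    using assms by (intro mult_mono) auto
  then show "norm ((r *\<^sub>R M) *v v) \<le> norm v"
    using assms by (simp add: scaleR_matrix_vector)
qed

lemma contraction_adjoint:
  assumes "contraction M"
  shows "contraction (hermitian_adjoint M)"
  unfolding contraction_def
proof
  fix v
  let ?w = "hermitian_adjoint M *v v"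
  have "norm ?w ^ 2 = v \<bullet> (M *v ?w)"
    by (simp add: power2_norm_eq_inner inner_adjoint)
  also have "\<dots> \<le> norm v * norm (M *v ?w)"
    by (rule norm_cauchy_schwarz)
  also have "\<dots> \<le> norm v * norm ?w"
    using assms by (simp add: contraction_def mult_left_mono)
  finally show "norm ?w \<le> norm v"
    by (cases "?w = 0") (auto simp: power2_eq_square)
qed

lemma contraction_entry_le:
  assumes "contraction M"
  shows "norm (M $ i $ j) \<le> 1"
proof -
  have "M $ i $ j = (M *v axis j 1) $ i"
    by (simp add: matrix_vector_mult_def axis_def if_distrib cong: if_cong)
  then have "norm (M $ i $ j) \<le> norm (M *v axis j 1)"
    by (metis Finite_Cartesian_Product.norm_nth_le)
  also have "\<dots> \<le> norm (axis j 1 :: complex^_)"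
    using assms contraction_def by blast
  also have "\<dots> = 1" by simp
  finally show ?thesis .
qed

lemma mat_1_contraction [simp]: "contraction (mat 1)"
  by (simp add: contraction_def)

text \<open>By the parallelogram law the squared norms of \<open>A *v v\<close> and
  \<open>C *v v\<close> sum to at most that of \<open>v\<close>; where \<open>C\<close> preserves
  the norm, nothing is left for \<open>A\<close>.\<close>

lemma contraction_add_diff_kernel:
  assumes "contraction (A + C)" "contraction (A - C)" "norm (C *v v) = norm v"
  shows "A *v v = 0"
proof -
  have 1: "norm (A *v v + C *v v) \<le> norm v" "norm (A *v v - C *v v) \<le> norm v"
    using assms(1,2) unfolding contraction_def
    by (metis matrix_vector_mult_add_rdistrib, metis matrix_vector_mult_diff_rdistrib)
  have "norm (A *v v + C *v v)^2 + norm (A *v v - C *v v)^2 = 2 * norm (A *v v)^2 + 2 * norm (C *v v)^2"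
    by (simp add: power2_norm_eq_inner algebra_simps)
  moreover have "norm (A *v v + C *v v)^2 + norm (A *v v - C *v v)^2 \<le> norm v^2 + norm v^2"
    by (intro add_mono power_mono 1) auto
  ultimately show ?thesis using assms(3) by simp
qed

subsection \<open>Orthogonal projectors\<close>

definition is_orthogonal_projector :: "(complex^'m::finite) set \<Rightarrow> complex^'m^'m \<Rightarrow> bool"
  where "is_orthogonal_projector W P \<longleftrightarrow>
    P ** P = P \<and> hermitian_adjoint P = P \<and> range ((*v) P) = W"

lemma projector_fixes:
  assumes "P ** P = P" "w \<in> range ((*v) P)"
  shows "P *v w = w"
  using assms by (metis imageE matrix_vector_mul_assoc)

text \<open>Each projector fixes the range of the other; taking the adjoint of
  \<open>Q ** P = P\<close> gives \<open>P = P ** Q = Q\<close>.\<close>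

lemma is_orthogonal_projector_unique:
  assumes P: "is_orthogonal_projector W P" and Q: "is_orthogonal_projector W Q"
  shows "P = Q"
proof -
  have *: "Q ** P = P" if "is_orthogonal_projector W P" "is_orthogonal_projector W Q" for P Q
  proof -
    have "Q *v (P *v v) = P *v v" for v
      using that by (intro projector_fixes) (auto simp: is_orthogonal_projector_def)
    then show ?thesis by (simp add: matrix_eq flip: matrix_vector_mul_assoc)
  qed
  have "P = hermitian_adjoint P" using P by (simp add: is_orthogonal_projector_def)
  also have "\<dots> = hermitian_adjoint (Q ** P)" using *[OF P Q] by simp
  also have "\<dots> = P ** Q"
    using P Q by (simp add: hermitian_adjoint_mult is_orthogonal_projector_def)
  also have "\<dots> = Q" using *[OF Q P] .
  finally show ?thesis .
qed

text \<open>A complex subspace is also a real one, so the real orthogonal decomposition applies;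
  closure of \<open>W\<close> under multiplication by \<i> makes the residual complex-orthogonal to
  \<open>W\<close>.\<close>

lemma is_orthogonal_projector_exists:
  assumes W: "vec.subspace W"
  shows "\<exists>P. is_orthogonal_projector W P"
proof -
  have sub: "subspace W"
  proof (unfold subspace_def, intro conjI ballI allI)
    fix c :: real and x assume "x \<in> W"
    then have "(of_real c :: complex) *s x \<in> W" using W by (simp add: vec.subspace_scale)
    moreover have "(of_real c :: complex) *s x = c *\<^sub>R x"
      by (simp add: vec_eq_iff) (simp add: scaleR_conv_of_real)
    ultimately show "c *\<^sub>R x \<in> W" by simp
  qed (use W in \<open>auto simp: vec.subspace_def\<close>)
  have ex: "\<exists>y. y \<in> W \<and> (\<forall>w\<in>W. cinner w (x - y) = 0)" for x
  proof -
    obtain y z where yz: "y \<in> span W" "\<And>w. w \<in> span W \<Longrightarrow> orthogonal z w" "x = y + z"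
      using orthogonal_subspace_decomp_exists[of W x] by metis
    have spanW: "span W = W" using sub by (simp add: span_eq_iff)
    have "cinner w (x - y) = 0" if "w \<in> W" for w
    proof -
      have "\<i> *s w \<in> W" using W that by (simp add: vec.subspace_scale)
      then have "z \<bullet> w = 0" "z \<bullet> (\<i> *s w) = 0"
        using yz(2) spanW that by (auto simp: orthogonal_def)
      then have "cinner z w = 0" by (simp add: cinner_eq_0_iff)
      then show ?thesis using yz(3) cinner_commute[of w z] by simp
    qed
    then show ?thesis using yz spanW by auto
  qed
  then obtain p where p: "\<And>x. p x \<in> W" "\<And>x w. w \<in> W \<Longrightarrow> cinner w (x - p x) = 0"
    by metis
  \<comment> \<open>Being the point of \<open>W\<close> with residual orthogonal to \<open>W\<close>
    determines \<open>p x\<close>; linearity and idempotence both follow from this.\<close>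
  have uniq: "p x = y" if "y \<in> W" "\<And>w. w \<in> W \<Longrightarrow> cinner w (x - y) = 0" for x y
  proof -
    have "p x - y \<in> W" using that p W by (simp add: vec.subspace_diff)
    then have "cinner (p x - y) (x - y) = 0" "cinner (p x - y) (x - p x) = 0"
      using that p by auto
    moreover have "cinner (p x - y) (x - y) = cinner (p x - y) (x - p x) + cinner (p x - y) (p x - y)"
      by (simp flip: cinner_add_right)
    ultimately have "cinner (p x - y) (p x - y) = 0" by simp
    then have "p x - y = 0" by (rule cinner_self_eq_0D)
    then show ?thesis by simp
  qed
  have lin: "Vector_Spaces.linear (*s) (*s) p"
  proof unfold_locales
    fix x y :: "complex^'a" and c :: complex
    show "p (x + y) = p x + p y"
    proof (rule uniq)
      show "p x + p y \<in> W" using p W by (simp add: vec.subspace_add)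
      fix w assume "w \<in> W"
      then have "cinner w (x - p x) + cinner w (y - p y) = 0" using p by simp
      then show "cinner w (x + y - (p x + p y)) = 0"
        by (simp add: algebra_simps flip: cinner_add_right)
    qed
    show "p (c *s x) = c *s p x"
    proof (rule uniq)
      show "c *s p x \<in> W" using p W by (simp add: vec.subspace_scale)
      fix w assume "w \<in> W"
      then have "cinner w (c *s (x - p x)) = 0"
        unfolding cinner_scale_right using p by simp
      moreover have "c *s (x - p x) = c *s x - c *s p x"
        by (simp add: vec_eq_iff algebra_simps)
      ultimately show "cinner w (c *s x - c *s p x) = 0" by simp
    qed
  qed
  define P where "P = matrix p"
  have P: "P *v x = p x" for x using matrix_works[OF lin] by (simp add: P_def)
  have pW: "p w = w" if "w \<in> W" for w using that by (intro uniq) auto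
  have "is_orthogonal_projector W P"
    unfolding is_orthogonal_projector_def
  proof (intro conjI)
    have "P *v (P *v x) = P *v x" for x unfolding P using pW p by blast
    then show "P ** P = P" unfolding matrix_eq by (simp add: matrix_vector_mul_assoc)
    show "range ((*v) P) = W"
    proof
      show "range ((*v) P) \<subseteq> W" using P p by auto
      show "W \<subseteq> range ((*v) P)"
      proof
        fix w assume "w \<in> W"
        then have "w = P *v w" using P pW by simp
        then show "w \<in> range ((*v) P)" by blast
      qed
    qed
    have eq: "cinner (p u) v = cinner (p u) (p v)" for u v
    proof -
      have "cinner (p u) v = cinner (p u) (v - p v) + cinner (p u) (p v)"
        by (simp flip: cinner_add_right)
      then show ?thesis using p by simp
    qed
    have sym: "cinner (p u) v = cinner u (p v)" for u v
      using eq[of u v] eq[of v u] cinner_commute[of u "p v"] cinner_commute[of "p u" "p v"] by simp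
    have "hermitian_adjoint P *v u = P *v u" for u
    proof -
      let ?d = "hermitian_adjoint P *v u - P *v u"
      have "cinner (hermitian_adjoint P *v u) v = cinner (P *v u) v" for v
        using sym by (simp add: cinner_adjoint P)
      then have "(hermitian_adjoint P *v u) \<bullet> v = (P *v u) \<bullet> v" for v
        by (simp add: inner_eq_Re_cinner)
      then show ?thesis by (subst vector_eq_rdot[symmetric]) simp
    qed
    then show "hermitian_adjoint P = P" by (simp add: matrix_eq)
  qed
  then show ?thesis by blast
qed

lemma is_orthogonal_projector_orthogonal_projector:
  assumes "vec.subspace W"
  shows "is_orthogonal_projector W (orthogonal_projector W)"
proof -
  have "\<exists>!P. is_orthogonal_projector W P"
    using is_orthogonal_projector_exists[OF assms] is_orthogonal_projector_unique by blast
  from theI'[OF this] show ?thesis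
    by (simp add: orthogonal_projector_def is_orthogonal_projector_def)
qed

subsection \<open>Polynomials in a matrix\<close>

text \<open>This is p(M) u, evaluated by Horner's scheme directly on the vector.\<close>

definition poly_orbit :: "complex^'m^'m::finite \<Rightarrow> complex poly \<Rightarrow> complex^'m \<Rightarrow> complex^'m"
  where "poly_orbit M p u = fold_coeffs (\<lambda>a v. a *s u + M *v v) p 0"

lemma poly_orbit_0 [simp]: "poly_orbit M 0 u = 0"
  by (simp add: poly_orbit_def)

lemma poly_orbit_pCons [simp]: "poly_orbit M (pCons a p) u = a *s u + M *v poly_orbit M p u"
  by (cases "p = 0 \<and> a = 0") (auto simp: poly_orbit_def)

lemma poly_orbit_add: "poly_orbit M (p + q) u = poly_orbit M p u + poly_orbit M q u"
  by (induction p q rule: poly_induct2)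
     (auto simp: matrix_vector_right_distrib vec.scale_left_distrib)

lemma poly_orbit_smult: "poly_orbit M (smult c p) u = c *s poly_orbit M p u"
  by (induction p) (auto simp: vec.scale_right_distrib vector_smult_assoc vec.scale)

lemma poly_orbit_linear_factor:
  "poly_orbit M ([:- c, 1:] * q) u = M *v poly_orbit M q u - c *s poly_orbit M q u"
proof -
  have "[:- c, 1:] * q = smult (- c) q + pCons 0 q" by simp
  then show ?thesis
    by (simp only: poly_orbit_add poly_orbit_smult poly_orbit_pCons) (simp add: vec.scale_minus_left)
qed

lemma poly_orbit_diff_arg: "poly_orbit M q (u - v) = poly_orbit M q u - poly_orbit M q v"
  by (induction q) (auto simp: vec.scale_right_diff_distrib matrix_vector_mult_diff_distrib)

lemma poly_orbit_scale_arg: "poly_orbit M q (c *s u) = c *s poly_orbit M q u"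
  by (induction q) (auto simp: vec.scale_right_distrib vector_smult_assoc vec.scale mult.commute)

lemma poly_orbit_apply_arg: "poly_orbit M q (M *v u) = M *v poly_orbit M q u"
  by (induction q) (auto simp: matrix_vector_right_distrib vec.scale)

lemma poly_orbit_monom: "poly_orbit M (monom c i) u = c *s (((*v) M ^^ i) u)"
  by (induction i) (auto simp: monom_0 monom_Suc vec.scale)

lemma poly_orbit_sum: "poly_orbit M (\<Sum>i\<in>I. p i) u = (\<Sum>i\<in>I. poly_orbit M (p i) u)"
  by (induction I rule: infinite_finite_induct) (auto simp: poly_orbit_add)

text \<open>The vectors u, M u, M^2 u, ... up to exponent \<open>CARD('m)\<close> are one more than
  the dimension, and a linear dependence among them is the coefficient list of
  \<open>p\<close>.\<close>

lemma annihilating_poly_exists: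
  fixes M :: "complex^'m^'m::finite"
  shows "\<exists>p. p \<noteq> 0 \<and> poly_orbit M p u = 0"
proof -
  define f where "f = (\<lambda>i. ((*v) M ^^ i) u)"
  let ?N = "CARD('m)"
  show ?thesis
  proof (cases "inj_on f {..?N}")
    \<comment> \<open>Dependence concerns the set of iterates, so a repetition is treated apart; it
      yields the relation x^i - x^j.\<close>
    case False
    then obtain i j where ij: "i \<noteq> j" "f i = f j" by (auto simp: inj_on_def)
    let ?p = "monom 1 i + monom (- 1) j :: complex poly"
    have "coeff ?p i = 1" using ij by simp
    then have "?p \<noteq> 0" by (metis coeff_0 zero_neq_one)
    moreover have "poly_orbit M ?p u = 0"
      using ij by (simp add: poly_orbit_add poly_orbit_monom f_def vec.scale_minus_left)
    ultimately show ?thesis by blast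
  next
    case True
    then have card: "card (f ` {..?N}) = Suc ?N" by (simp add: card_image)
    have "vec.dependent (f ` {..?N})"
    proof (rule ccontr)
      assume "\<not> vec.dependent (f ` {..?N})"
      then have "card (f ` {..?N}) \<le> vec.dim (UNIV :: (complex^'m) set)"
        by (intro vec.independent_card_le_dim) auto
      then show False using card by (simp add: card_cart_basis)
    qed
    then obtain g where g: "(\<Sum>v\<in>f ` {..?N}. g v *s v) = 0" "\<exists>v\<in>f ` {..?N}. g v \<noteq> 0"
      using vec.dependent_finite[of "f ` {..?N}"] by auto
    define p where "p = (\<Sum>i\<le>?N. monom (g (f i)) i)"
    obtain i where "i \<le> ?N" "g (f i) \<noteq> 0" using g(2) by auto
    then have "coeff p i \<noteq> 0" by (simp add: p_def coeff_sum)
    then have "p \<noteq> 0" by auto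
    moreover have "poly_orbit M p u = 0"
      using g(1) sum.reindex[OF True, of "\<lambda>v. g v *s v"]
      by (simp add: p_def poly_orbit_sum poly_orbit_monom f_def o_def)
    ultimately show ?thesis by blast
  qed
qed

subsection \<open>Preserved and dissipative modes\<close>

text \<open>All that is used of complete positivity at a fixed momentum. \<open>X\<close> is not
  restricted to antihermitian matrices, so that the identity and its negative may be
  inserted.\<close>

definition contractive_pair :: "complex^'m^'m::finite \<Rightarrow> complex^'m^'m \<Rightarrow> bool"
  where "contractive_pair A B \<longleftrightarrow> contraction B \<and>
    (\<forall>X. contraction X \<longrightarrow> contraction (A + B ** X ** hermitian_adjoint B))"

text \<open>The squared distance between \<open>hermitian_adjoint B *v v\<close> and
  \<open>cnj z *s v\<close> expands to at most |v|^2 - 2 |v|^2 + |v|^2 = 0, the middle term coming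
  from the eigenvalue equation.\<close>

lemma unimodular_eigenvector_adjoint:
  assumes "contraction B" "B *v v = z *s v" "norm z = 1"
  shows "hermitian_adjoint B *v v = cnj z *s v"
proof -
  let ?w = "hermitian_adjoint B *v v"
  have zz: "cnj z * z = 1" using assms(3) complex_norm_square[of z] by (simp add: mult.commute)
  have "?w \<bullet> (cnj z *s v) = v \<bullet> v"
    by (simp add: inner_adjoint vec.scale assms(2) vector_smult_assoc zz)
  moreover have "norm ?w \<le> norm v"
    using contraction_adjoint[OF assms(1)] by (simp add: contraction_def)
  then have "?w \<bullet> ?w \<le> v \<bullet> v" by (simp add: norm_le)
  moreover have "(cnj z *s v) \<bullet> (cnj z *s v) = v \<bullet> v"
    using assms(3) by (simp add: norm_smult_vec flip: power2_norm_eq_inner)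
  ultimately have "(?w - cnj z *s v) \<bullet> (?w - cnj z *s v) \<le> 0"
    by (simp add: inner_diff_left inner_diff_right inner_commute)
  then have "?w - cnj z *s v = 0" by (metis inner_eq_zero_iff inner_ge_zero order_antisym)
  then show ?thesis by simp
qed

lemma preserved_space_kernel:
  assumes "\<And>v z. norm z = 1 \<Longrightarrow> B *v v = z *s v \<Longrightarrow> M *v v = 0" "v \<in> preserved_space B"
  shows "M *v v = 0"
proof -
  have "vec.subspace {v. M *v v = 0}"
    by (auto simp: vec.subspace_def matrix_vector_right_distrib vec.scale)
  then have "preserved_space B \<subseteq> {v. M *v v = 0}"
    unfolding preserved_space_def using assms(1) by (intro vec.span_minimal) auto
  then show ?thesis using assms(2) by auto
qed

text \<open>Unimodular eigenvectors of \<open>B\<close> are eigenvectors of its adjoint too, so the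
  adjoint keeps their span; dually, \<open>B\<close> keeps the orthogonal complement.\<close>

lemma preserved_space_adjoint_invariant:
  assumes "contraction B" "v \<in> preserved_space B"
  shows "hermitian_adjoint B *v v \<in> preserved_space B"
proof -
  let ?S = "{v. hermitian_adjoint B *v v \<in> preserved_space B}"
  have "vec.subspace ?S"
    by (auto simp: vec.subspace_def matrix_vector_right_distrib vec.scale preserved_space_def
        vec.span_zero vec.span_add vec.span_scale)
  moreover have "v \<in> ?S" if "v \<noteq> 0" "norm z = 1" "B *v v = z *s v" for v z
  proof -
    have "v \<in> preserved_space B"
      unfolding preserved_space_def using that by (intro vec.span_base) auto
    then show ?thesis using unimodular_eigenvector_adjoint[OF assms(1) that(3,2)]
      by (simp add: preserved_space_def vec.span_scale)
  qed
  ultimately have "preserved_space B \<subseteq> ?S"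
    by (subst (1) preserved_space_def, intro vec.span_minimal) auto
  then show ?thesis using assms(2) by auto
qed

lemma subspace_dissipative_space: "vec.subspace (dissipative_space B)"
  by (auto simp: vec.subspace_def dissipative_space_def cinner_add_right cinner_scale_right)

lemma dissipative_space_invariant:
  assumes "contraction B" "v \<in> dissipative_space B"
  shows "B *v v \<in> dissipative_space B"
  using assms preserved_space_adjoint_invariant
  by (auto simp: dissipative_space_def simp flip: cinner_adjoint)

lemma dissipative_eigenvector_eq_0:
  assumes "B *v v = z *s v" "norm z = 1" "v \<in> dissipative_space B"
  shows "v = 0"
proof (rule ccontr)
  assume "v \<noteq> 0"
  then have "v \<in> preserved_space B"
    unfolding preserved_space_def using assms by (intro vec.span_base) auto
  then have "cinner v v = 0" using assms(3) by (simp add: dissipative_space_def)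
  then show False using cinner_self_eq_0D \<open>v \<noteq> 0\<close> by blast
qed

abbreviation dissipative_projector :: "complex^'m^'m::finite \<Rightarrow> complex^'m^'m"
  where "dissipative_projector B \<equiv> orthogonal_projector (dissipative_space B)"

lemma dissipative_projector:
  "dissipative_projector B ** dissipative_projector B = dissipative_projector B"
  "hermitian_adjoint (dissipative_projector B) = dissipative_projector B"
  "range ((*v) (dissipative_projector B)) = dissipative_space B"
  using is_orthogonal_projector_orthogonal_projector[OF subspace_dissipative_space]
  by (auto simp: is_orthogonal_projector_def)

lemma dissipative_projector_absorbs:
  assumes "\<And>v. M *v v \<in> dissipative_space B"
  shows "dissipative_projector B ** M = M"
  unfolding matrix_eq matrix_vector_mul_assoc[symmetric]
  using assms by (intro allI projector_fixes) (simp_all add: dissipative_projector)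

lemma dissipative_projector_comm:
  assumes "contraction B"
  shows "dissipative_projector B ** (B ** dissipative_projector B) = B ** dissipative_projector B"
  using dissipative_projector(3)[of B] dissipative_space_invariant[OF assms]
  by (intro dissipative_projector_absorbs) (auto simp flip: matrix_vector_mul_assoc)

text \<open>Inserting \<open>mat 1\<close> and \<open>- mat 1\<close> for \<open>X\<close> makes A +
  B B\<dagger> and A - B B\<dagger> contractions, while B B\<dagger> preserves the norm of
  unimodular eigenvectors. The parallelogram argument then applies to \<open>A\<close> and, after
  taking adjoints, to its adjoint.\<close>

lemma contractive_pair_kernel:
  assumes "contractive_pair A B" "v \<in> preserved_space B"
  shows "A *v v = 0" "hermitian_adjoint A *v v = 0"
proof -
  let ?C = "B ** hermitian_adjoint B"
  have B: "contraction B" using assms by (simp add: contractive_pair_def)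
  have p: "contraction (A + ?C)"
    using assms(1)[unfolded contractive_pair_def, THEN conjunct2, rule_format, of "mat 1"] by simp
  have neg: "(- M) ** N = - (M ** N)" "M ** (- N) = - (M ** N)" for M N :: "complex^'a^'a"
    by (simp_all add: matrix_matrix_mult_def vec_eq_iff sum_negf)
  have "contraction (- mat 1 :: complex^'a^'a)"
    using matrix_vector_mult_diff_rdistrib[of 0 "mat 1 :: complex^'a^'a"]
    by (simp add: contraction_def)
  moreover have "B ** (- mat 1) ** hermitian_adjoint B = - ?C"
    by (simp add: neg)
  ultimately have m: "contraction (A - ?C)"
    using assms(1)[unfolded contractive_pair_def, THEN conjunct2, rule_format, of "- mat 1"] by simp
  have C': "hermitian_adjoint ?C = ?C"
    by (simp add: hermitian_adjoint_mult)
  have adj: "hermitian_adjoint (A + ?C) = hermitian_adjoint A + hermitian_adjoint ?C"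
     "hermitian_adjoint (A - ?C) = hermitian_adjoint A - hermitian_adjoint ?C"
    by (simp_all add: hermitian_adjoint_def vec_eq_iff transpose_def)
  have C: "norm (?C *v v) = norm v" if "norm z = 1" "B *v v = z *s v" for z v
  proof -
    have "?C *v v = B *v (hermitian_adjoint B *v v)"
      by (simp add: matrix_vector_mul_assoc)
    then show ?thesis
      using that by (simp add: unimodular_eigenvector_adjoint[OF B that(2,1)] vec.scale norm_smult_vec norm_mult)
  qed
  show "A *v v = 0"
    by (rule preserved_space_kernel[OF _ assms(2)], rule contraction_add_diff_kernel[OF p m C])
  show "hermitian_adjoint A *v v = 0"
    by (rule preserved_space_kernel[OF _ assms(2)], rule contraction_add_diff_kernel[OF _ _ C])
       (use contraction_adjoint[OF p] contraction_adjoint[OF m] in \<open>simp_all only: adj C'\<close>)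
qed

text \<open>The range of \<open>A\<close> is orthogonal to the kernel of its adjoint, which contains
  the preserved modes; the second identity is the same argument for the adjoint of
  \<open>A\<close>.\<close>

lemma contractive_pair_projector:
  assumes "contractive_pair A B"
  shows "dissipative_projector B ** A = A" "A ** dissipative_projector B = A"
proof -
  let ?P = "dissipative_projector B"
  show "?P ** A = A"
    by (rule dissipative_projector_absorbs)
       (auto simp: dissipative_space_def cinner_def contractive_pair_kernel[OF assms]
         simp flip: cinner_adjoint[unfolded cinner_def])
  have "?P ** hermitian_adjoint A = hermitian_adjoint A"
  proof (rule dissipative_projector_absorbs, unfold dissipative_space_def, intro CollectI ballI)
    fix u v assume "u \<in> preserved_space B"
    then have "cinner (A *v u) v = 0"
      by (simp add: contractive_pair_kernel[OF assms] cinner_def)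
    then show "cinner u (hermitian_adjoint A *v v) = 0"
      using cinner_adjoint[of "hermitian_adjoint A" u v] by simp
  qed
  from arg_cong[OF this, of hermitian_adjoint] show "A ** ?P = A"
    by (simp add: hermitian_adjoint_mult dissipative_projector)
qed

text \<open>Induction on the degree of a polynomial with \<open>p(B\<^sup>\<dagger>) u = 0\<close>: splitting off a root \<open>\<mu>\<close> of \<open>p\<close>
  yields \<open>Y u = \<mu> B (Y u)\<close>, where either \<open>|\<mu>| < 1\<close> or \<open>Y u\<close> is an eigenvector to an eigenvalue
  of modulus \<open>1\<close>.\<close>

lemma stationary_eq_0:
  assumes B: "contraction B" and Y: "Y = B ** Y ** hermitian_adjoint B"
    and range: "\<And>u. Y *v u \<in> dissipative_space B"
  shows "Y = 0"
proof -
  let ?M = "hermitian_adjoint B"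
  have Yu: "Y *v u = B *v (Y *v (?M *v u))" for u
    using arg_cong[OF Y, of "\<lambda>Y. Y *v u"] by (simp add: matrix_vector_mul_assoc matrix_mul_assoc)
  have "Y *v u = 0" if "p \<noteq> 0" "poly_orbit ?M p u = 0" for p u
    using that
  proof (induction "degree p" arbitrary: p u rule: less_induct)
    case less
    show ?case
    proof (cases "degree p = 0")
      case True
      then obtain a where "p = [:a:]" by (metis degree_eq_zeroE)
      then have "u = 0" using less.prems by auto
      then show ?thesis by simp
    next
      case False
      then obtain \<mu> where "poly p \<mu> = 0"
        using fundamental_theorem_of_algebra[of p] by (auto simp: constant_degree)
      then obtain q where p: "p = [:- \<mu>, 1:] * q" by (metis dvdE poly_eq_0_iff_dvd)
      then have q: "q \<noteq> 0" using less.prems(1) by auto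
      then have deg: "degree q < degree p" unfolding p by (subst degree_mult_eq) auto
      let ?v = "poly_orbit ?M q u"
      show ?thesis
      proof (cases "?v = 0")
        case True
        then show ?thesis using less.hyps deg q by blast
      next
        case False
        \<comment> \<open>Since p(M) u = 0, the nonzero \<open>?v\<close> is an eigenvector of the
          contraction \<open>?M\<close>, hence |\<mu>| \<le> 1.\<close>
        have v: "?M *v ?v = \<mu> *s ?v"
          using less.prems(2) unfolding p poly_orbit_linear_factor by simp
        have "norm (?M *v ?v) \<le> norm ?v"
          using contraction_adjoint[OF B] by (simp add: contraction_def)
        then have \<mu>: "norm \<mu> \<le> 1" using False v by (simp add: norm_smult_vec)
        \<comment> \<open>The factor \<open>q\<close> annihilates this shifted vector, so the
          induction hypothesis applies to it although not to \<open>u\<close>.\<close>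
        have "poly_orbit ?M q (?M *v u - \<mu> *s u) = 0"
          using v by (simp add: poly_orbit_diff_arg poly_orbit_scale_arg poly_orbit_apply_arg)
        then have "Y *v (?M *v u - \<mu> *s u) = 0" using less.hyps deg q by blast
        then have YM: "Y *v (?M *v u) = \<mu> *s (Y *v u)"
          by (simp add: matrix_vector_mult_diff_distrib vec.scale)
        then have eq: "Y *v u = \<mu> *s (B *v (Y *v u))"
          using Yu[of u, unfolded YM] by (simp only: vec.scale)
        show ?thesis
        proof (cases "norm \<mu> = 1")
          case True
          then have "\<mu> \<noteq> 0" by auto
          then have "B *v (Y *v u) = inverse \<mu> *s (Y *v u)"
            by (subst (2) eq) (simp add: vector_smult_assoc)
          then show ?thesis
            using True range by (intro dissipative_eigenvector_eq_0[of B _ "inverse \<mu>"]) (auto simp: norm_inverse)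
        next
          case False
          have "norm (Y *v u) = norm \<mu> * norm (B *v (Y *v u))"
            by (subst (1) eq) (simp only: norm_smult_vec)
          also have "\<dots> \<le> norm \<mu> * norm (Y *v u)"
            using B by (simp add: contraction_def mult_left_mono)
          finally have "(1 - norm \<mu>) * norm (Y *v u) \<le> 0" by (simp add: algebra_simps)
          then show ?thesis using False \<mu> by (simp add: mult_le_0_iff)
        qed
      qed
    qed
  qed
  then have "Y *v u = 0" for u using annihilating_poly_exists by blast
  then show ?thesis by (simp add: matrix_eq)
qed

section \<open>Characterisation of the dissipative steady state\<close>

lemma dissipative_projector_left:
  assumes "contraction B" "dissipative_projector B ** Z = Z"
  shows "dissipative_projector B ** (B ** Z) = B ** Z"
  by (metis dissipative_projector_comm[OF assms(1)] matrix_mul_assoc assms(2))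

lemma dissipative_projector_right:
  assumes "contraction B" "Z ** dissipative_projector B = Z"
  shows "Z ** hermitian_adjoint B ** dissipative_projector B = Z ** hermitian_adjoint B"
proof -
  let ?P = "dissipative_projector B" and ?H = "hermitian_adjoint B"
  have "?P ** ?H ** ?P = ?P ** ?H"
    using arg_cong[OF dissipative_projector_comm[OF assms(1)], of hermitian_adjoint]
    by (simp add: hermitian_adjoint_mult dissipative_projector matrix_mul_assoc)
  then show ?thesis by (metis matrix_mul_assoc assms(2))
qed

text \<open>Since \<open>A\<close> and \<open>B\<close> respect the dissipative space, the projected
  equation agrees with the plain one for operators living there. The difference of two solutions is
  stationary without source, hence 0 by \<open>stationary_eq_0\<close>; this settles the
  \<open>THE\<close>.\<close>

lemma dissipative_steady_state_eqI:
  assumes AB: "contractive_pair A B"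
    and X: "X = A + B ** X ** hermitian_adjoint B"
    and P: "dissipative_projector B ** X = X" "X ** dissipative_projector B = X"
  shows "dissipative_steady_state A B = X"
proof -
  let ?P = "dissipative_projector B" and ?H = "hermitian_adjoint B"
  have B: "contraction B" using AB by (simp add: contractive_pair_def)
  have iff: "is_dissipative_steady_state A B Z \<longleftrightarrow>
    ?P ** Z = Z \<and> Z ** ?P = Z \<and> Z = A + B ** Z ** ?H" for Z
  proof -
    have "?P ** B ** Z ** ?H ** ?P = B ** Z ** ?H" if "?P ** Z = Z" "Z ** ?P = Z"
      using dissipative_projector_left[OF B that(1)] dissipative_projector_right[OF B that(2)]
      by (metis matrix_mul_assoc)
    then show ?thesis
      unfolding is_dissipative_steady_state_def Let_def contractive_pair_projector[OF AB] by metis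
  qed
  have "Z = X" if Z: "is_dissipative_steady_state A B Z" for Z
  proof -
    have Z1: "?P ** Z = Z" "Z = A + B ** Z ** ?H" using Z iff by blast+
    have "Z - X = 0"
    proof (rule stationary_eq_0[OF B])
      have "B ** (Z - X) ** ?H = B ** Z ** ?H - B ** X ** ?H"
        by (simp add: matrix_eq matrix_vector_mult_diff_rdistrib matrix_vector_mult_diff_distrib
            flip: matrix_vector_mul_assoc)
      then show "Z - X = B ** (Z - X) ** ?H"
        using X Z1(2) by (metis add_diff_cancel_left)
      fix u
      have "(Z - X) *v u = ?P *v ((Z - X) *v u)"
        using Z1(1) P(1)
        by (simp add: matrix_vector_mult_diff_rdistrib matrix_vector_mult_diff_distrib matrix_vector_mul_assoc)
      then show "(Z - X) *v u \<in> dissipative_space B"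
        using dissipative_projector(3)[of B] by (metis rangeI)
    qed
    then show ?thesis by simp
  qed
  then show ?thesis
    unfolding dissipative_steady_state_def using iff[of X] X P by (intro the_equality) blast+
qed

subsection \<open>The damped steady-state equation\<close>

lemma matrix_mult_scaleR:
  fixes M :: "complex^'b^'a" and N :: "complex^'c^'b"
  shows "M ** (r *\<^sub>R N) = r *\<^sub>R (M ** N)" "(r *\<^sub>R M) ** N = r *\<^sub>R (M ** N)"
  by (simp_all add: matrix_matrix_mult_def vec_eq_iff scaleR_sum_right)

lemma matrix_mult_add_distrib_right: "(L + M) ** N = L ** N + M ** N"
  for L M :: "complex^'b^'a" and N :: "complex^'c^'b"
  by (simp add: matrix_matrix_mult_def vec_eq_iff distrib_right sum.distrib)

text \<open>Conjugation by the contraction \<open>B\<close> does not increase the operator norm, so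
  the norm K of \<open>Y\<close> satisfies K \<le> r K with r < 1.\<close>

lemma damped_stationary_eq_0:
  assumes B: "contraction B" and r: "0 \<le> r" "r < 1"
    and Y: "Y = B ** (r *\<^sub>R Y) ** hermitian_adjoint B"
  shows "Y = 0"
proof -
  have bl: "bounded_linear ((*v) Y)" by simp
  let ?K = "onorm ((*v) Y)"
  have "?K \<le> r * ?K"
  proof (rule onorm_le)
    fix v
    let ?w = "hermitian_adjoint B *v v"
    have "Y *v v = B *v ((r *\<^sub>R Y) *v ?w)"
      using arg_cong[OF Y, of "\<lambda>Y. Y *v v"] by (simp add: matrix_vector_mul_assoc matrix_mul_assoc)
    then have "norm (Y *v v) \<le> norm ((r *\<^sub>R Y) *v ?w)"
      using B by (simp add: contraction_def)
    also have "\<dots> = r * norm (Y *v ?w)" using r by (simp add: scaleR_matrix_vector)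
    also have "\<dots> \<le> r * (?K * norm ?w)"
      using r onorm[OF bl] by (intro mult_left_mono) auto
    also have "\<dots> \<le> r * (?K * norm v)"
      using r contraction_adjoint[OF B] onorm_pos_le[OF bl]
      by (intro mult_left_mono) (auto simp: contraction_def)
    finally show "norm (Y *v v) \<le> r * ?K * norm v" by simp
  qed
  then have "(1 - r) * ?K \<le> 0" by (simp add: algebra_simps)
  then have "?K \<le> 0" using r by (simp add: mult_le_0_iff)
  then have "?K = 0" using onorm_pos_le[OF bl] by simp
  then have "Y *v v = 0" for v using onorm_eq_0[OF bl] by simp
  then show ?thesis by (simp add: matrix_eq)
qed

lemma tendsto_matrix_vector_mult:
  fixes M :: "complex^'n^'m"
  assumes "(f \<longlongrightarrow> M) F" "(g \<longlongrightarrow> v) F"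
  shows "((\<lambda>x. f x *v g x) \<longlongrightarrow> M *v v) F"
  by (intro vec_tendstoI) (auto simp: matrix_vector_mult_def intro!: tendsto_intros assms)

text \<open>The solution is the limit of the iterates of X \<mapsto> A + r B X B\<dagger> started at
  0. Contractivity and confinement to the dissipative space hold for every iterate and pass to the
  limit.\<close>

lemma damped_solution:
  assumes AB: "contractive_pair A B" and r: "0 \<le> r" "r < 1"
    and X: "X = A + B ** (r *\<^sub>R X) ** hermitian_adjoint B"
  shows "contraction X" "dissipative_projector B ** X = X" "X ** dissipative_projector B = X"
proof -
  let ?P = "dissipative_projector B"
  let ?H = "hermitian_adjoint B"
  have B: "contraction B" using AB by (simp add: contractive_pair_def)
  define T where "T = (\<lambda>Z. A + B ** (r *\<^sub>R Z) ** ?H)"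
  have T: "T Z *v v = A *v v + B *v ((r *\<^sub>R Z) *v (?H *v v))" for Z v
    by (simp add: T_def matrix_vector_mult_add_rdistrib matrix_vector_mul_assoc matrix_mul_assoc)
  define Z where "Z = (\<lambda>n. (T ^^ n) 0)"
  have Z0: "Z 0 = 0" and ZSuc: "Z (Suc n) = T (Z n)" for n by (simp_all add: Z_def)
  have bl: "bounded_linear ((*v) X)" by simp
  have bound: "norm (Z n *v v - X *v v) \<le> r ^ n * (onorm ((*v) X) * norm v)" for n v
  proof (induction n arbitrary: v)
    case 0
    then show ?case using onorm[OF bl] by (simp add: Z0)
  next
    case (Suc n)
    have "X *v v = A *v v + B *v ((r *\<^sub>R X) *v (?H *v v))"
      using T[of X v] X by (simp add: T_def)
    then have "Z (Suc n) *v v - X *v v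
        = B *v (r *\<^sub>R (Z n *v (?H *v v) - X *v (?H *v v)))"
      by (simp add: ZSuc T scaleR_matrix_vector scaleR_diff_right matrix_vector_mult_diff_distrib)
    then have "norm (Z (Suc n) *v v - X *v v)
        \<le> norm (r *\<^sub>R (Z n *v (?H *v v) - X *v (?H *v v)))"
      using B unfolding contraction_def by metis
    also have "\<dots> \<le> r * (r ^ n * (onorm ((*v) X) * norm (?H *v v)))"
      using r Suc by (simp add: mult_left_mono)
    also have "\<dots> \<le> r * (r ^ n * (onorm ((*v) X) * norm v))"
      using r contraction_adjoint[OF B] onorm_pos_le[OF bl]
      by (intro mult_left_mono) (auto simp: contraction_def)
    finally show ?case by simp
  qed
  have lim: "(\<lambda>n. Z n *v v) \<longlonglongrightarrow> X *v v" for v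
  proof -
    have "(\<lambda>n. r ^ n * (onorm ((*v) X) * norm v)) \<longlonglongrightarrow> 0"
      using r by (intro tendsto_mult_left_zero LIMSEQ_power_zero) auto
    then have "(\<lambda>n. Z n *v v - X *v v) \<longlonglongrightarrow> 0"
      by (rule Lim_null_comparison[rotated]) (use bound in auto)
    then show ?thesis by (simp add: LIM_zero_iff)
  qed
  have "contraction (Z n)" for n
  proof (induction n)
    case (Suc n)
    then have "contraction (r *\<^sub>R Z n)" using r by (intro contraction_scaleR) auto
    then show ?case using AB by (simp add: ZSuc T_def contractive_pair_def)
  qed (simp add: Z0)
  then have Zn: "norm (Z n *v v) \<le> norm v" for n v by (simp add: contraction_def)
  show "contraction X"
    unfolding contraction_def
    by (intro allI LIMSEQ_le_const2[OF tendsto_norm[OF lim]]) (use Zn in auto)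
  have PZ: "?P ** Z n = Z n" for n
  proof (induction n)
    case (Suc n)
    have "?P ** (B ** (r *\<^sub>R Z n)) = B ** (r *\<^sub>R Z n)"
      by (intro dissipative_projector_left B) (simp add: matrix_mult_scaleR Suc)
    then show ?case
      by (simp add: ZSuc T_def matrix_add_ldistrib contractive_pair_projector[OF AB] matrix_mul_assoc)
  qed (simp add: Z0)
  have ZP: "Z n ** ?P = Z n" for n
  proof (induction n)
    case (Suc n)
    have "B ** (r *\<^sub>R Z n) ** ?H ** ?P = B ** (r *\<^sub>R Z n) ** ?H"
      by (intro dissipative_projector_right B)
         (simp add: matrix_mult_scaleR Suc flip: matrix_mul_assoc)
    then show ?case
      by (simp add: ZSuc T_def matrix_mult_add_distrib_right contractive_pair_projector[OF AB])
  qed (simp add: Z0)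
  have "?P *v (X *v v) = X *v v" for v
  proof (rule LIMSEQ_unique)
    show "(\<lambda>n. ?P *v (Z n *v v)) \<longlonglongrightarrow> ?P *v (X *v v)"
      by (intro tendsto_matrix_vector_mult tendsto_const lim)
    show "(\<lambda>n. ?P *v (Z n *v v)) \<longlonglongrightarrow> X *v v"
      using lim by (simp add: matrix_vector_mul_assoc PZ)
  qed
  then show "?P ** X = X" unfolding matrix_eq by (simp add: matrix_vector_mul_assoc)
  have "X *v (?P *v v) = X *v v" for v
  proof (rule LIMSEQ_unique)
    show "(\<lambda>n. Z n *v (?P *v v)) \<longlonglongrightarrow> X *v (?P *v v)" by (rule lim)
    show "(\<lambda>n. Z n *v (?P *v v)) \<longlonglongrightarrow> X *v v"
      using lim by (simp add: matrix_vector_mul_assoc ZP)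
  qed
  then show "X ** ?P = X" unfolding matrix_eq by (simp add: matrix_vector_mul_assoc)
qed

text \<open>The damped equation and the projector identities are preserved under limits, so at r = 1
  \<open>dissipative_steady_state_eqI\<close> identifies the limit.\<close>

lemma dissipative_steady_state_limit:
  assumes AB: "contractive_pair A B"
    and X: "\<And>r. 0 \<le> r \<Longrightarrow> r < 1 \<Longrightarrow> X r = A + B ** (r *\<^sub>R X r) ** hermitian_adjoint B"
    and lim: "(X \<longlongrightarrow> L) (at_left 1)"
  shows "dissipative_steady_state A B = L"
proof (rule dissipative_steady_state_eqI[OF AB])
  let ?P = "dissipative_projector B" and ?H = "hermitian_adjoint B"
  have ev: "eventually (\<lambda>r. 0 \<le> r \<and> r < 1) (at_left (1::real))"
    using eventually_at_left_real[of 0 1] by (auto elim: eventually_mono)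
  \<comment> \<open>Transfers an identity from r < 1 to the limit; \<open>h\<close> may depend on
    \<open>r\<close> itself because the damped equation does.\<close>
  have eq: "f L v = g L v"
    if "((\<lambda>r. f (X r) v) \<longlongrightarrow> f L v) (at_left 1)" "((\<lambda>r. h r (X r) v) \<longlongrightarrow> g L v) (at_left 1)"
      "\<And>r. 0 \<le> r \<Longrightarrow> r < 1 \<Longrightarrow> f (X r) v = h r (X r) v"
    for f g :: "complex^'a^'a \<Rightarrow> complex^'a \<Rightarrow> complex^'a" and h v
  proof (rule tendsto_unique[OF _ that(1)])
    show "((\<lambda>r. f (X r) v) \<longlongrightarrow> g L v) (at_left 1)"
      using that(2) by (rule Lim_transform_eventually) (use ev that(3) in \<open>auto elim!: eventually_mono\<close>)
  qed simp
  have "L *v v = A *v v + B *v ((1 *\<^sub>R L) *v (?H *v v))" for v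
  proof (rule eq[where f = "\<lambda>X. (*v) X" and g = "\<lambda>X v. A *v v + B *v ((1 *\<^sub>R X) *v (?H *v v))"
        and h = "\<lambda>r X v. A *v v + B *v ((r *\<^sub>R X) *v (?H *v v))"])
    fix r :: real assume "0 \<le> r" "r < 1"
    from arg_cong[OF X[OF this], of "\<lambda>Y. Y *v v"]
    show "X r *v v = A *v v + B *v ((r *\<^sub>R X r) *v (?H *v v))"
      by (simp add: matrix_vector_mult_add_rdistrib matrix_vector_mul_assoc matrix_mul_assoc)
  qed (intro tendsto_intros tendsto_matrix_vector_mult lim)+
  then show "L = A + B ** L ** ?H"
    unfolding matrix_eq
    by (simp add: matrix_vector_mult_add_rdistrib matrix_vector_mul_assoc matrix_mul_assoc)
  have "?P *v (L *v v) = L *v v" for v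
  proof (rule eq[where f = "\<lambda>X v. ?P *v (X *v v)" and g = "\<lambda>X v. X *v v" and h = "\<lambda>r X v. X *v v"])
    fix r :: real assume r: "0 \<le> r" "r < 1"
    show "?P *v (X r *v v) = X r *v v"
      unfolding matrix_vector_mul_assoc damped_solution(2)[OF AB r X[OF r]] ..
  qed (intro tendsto_matrix_vector_mult tendsto_const lim)+
  then show "?P ** L = L" unfolding matrix_eq by (simp add: matrix_vector_mul_assoc)
  have "L *v (?P *v v) = L *v v" for v
  proof (rule eq[where f = "\<lambda>X v. X *v (?P *v v)" and g = "\<lambda>X v. X *v v" and h = "\<lambda>r X v. X *v v"])
    fix r :: real assume r: "0 \<le> r" "r < 1"
    show "X r *v (?P *v v) = X r *v v"
      unfolding matrix_vector_mul_assoc damped_solution(3)[OF AB r X[OF r]] ..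
  qed (intro tendsto_matrix_vector_mult tendsto_const lim)+
  then show "L ** ?P = L" unfolding matrix_eq by (simp add: matrix_vector_mul_assoc)
qed

text \<open>Matrices \<open>X\<close> are flattened to vectors indexed by pairs, so that the equation
  \<open>X = A + r B X B\<^sup>\<dagger>\<close> becomes a linear system to which Cramer's rule applies.\<close>

definition flatten_matrix :: "complex^'m^'m \<Rightarrow> complex^('m::finite \<times> 'm)"
  where "flatten_matrix X = (\<chi> p. X $ fst p $ snd p)"

text \<open>The identity minus \<open>r\<close> times the Kronecker product of \<open>B\<close> with
  its complex conjugate.\<close>

definition damped_system :: "complex^'m^'m::finite \<Rightarrow> real \<Rightarrow> complex^('m \<times> 'm)^('m \<times> 'm)"
  where "damped_system B r =
    (\<chi> p q. (if p = q then 1 else 0) + of_real (- r) * (B $ fst p $ fst q * cnj (B $ snd p $ snd q)))"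

definition damped_numerator ::
  "complex^'m^'m::finite \<Rightarrow> complex^'m^'m \<Rightarrow> 'm \<times> 'm \<Rightarrow> real \<Rightarrow> complex"
  where "damped_numerator A B p r =
    det (\<chi> i j. if j = p then flatten_matrix A $ i else damped_system B r $ i $ j)"

lemma flatten_matrix_inject: "flatten_matrix X = flatten_matrix Y \<longleftrightarrow> X = Y"
  by (auto simp: flatten_matrix_def vec_eq_iff)

lemma damped_system_flatten:
  "damped_system B r *v flatten_matrix X = flatten_matrix (X - B ** (r *\<^sub>R X) ** hermitian_adjoint B)"
proof -
  have "(damped_system B r *v flatten_matrix X) $ p
      = flatten_matrix (X - B ** (r *\<^sub>R X) ** hermitian_adjoint B) $ p" for p
  proof -
    obtain a b where p: "p = (a, b)" by (cases p)
    have sc: "(r *\<^sub>R X) $ i $ j = of_real r * X $ i $ j" for i j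
      by (simp add: scaleR_conv_of_real[of r "X $ i $ j"])
    have "(damped_system B r *v flatten_matrix X) $ p
        = (\<Sum>q\<in>UNIV. (if p = q then X $ fst q $ snd q else 0))
          + of_real (- r) * (\<Sum>q\<in>UNIV. B $ a $ fst q * cnj (B $ b $ snd q) * X $ fst q $ snd q)"
      unfolding sum_distrib_left sum.distrib[symmetric]
      by (auto simp: p matrix_vector_mult_def damped_system_def flatten_matrix_def algebra_simps
          intro!: sum.cong)
    also have "(\<Sum>q\<in>UNIV. (if p = q then X $ fst q $ snd q else 0)) = X $ a $ b"
      by (simp add: p)
    also have "(\<Sum>q\<in>UNIV. B $ a $ fst q * cnj (B $ b $ snd q) * X $ fst q $ snd q)
        = (\<Sum>c\<in>UNIV. \<Sum>d\<in>UNIV. B $ a $ c * cnj (B $ b $ d) * X $ c $ d)"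
      by (simp add: sum.cartesian_product case_prod_beta flip: UNIV_Times_UNIV)
    also have "\<dots> = (\<Sum>d\<in>UNIV. \<Sum>c\<in>UNIV. B $ a $ c * cnj (B $ b $ d) * X $ c $ d)"
      by (rule sum.swap)
    also have "X $ a $ b + of_real (- r) * \<dots>
        = flatten_matrix (X - B ** (r *\<^sub>R X) ** hermitian_adjoint B) $ p"
      by (simp add: p flatten_matrix_def matrix_matrix_mult_def hermitian_adjoint_def transpose_def
          del: vector_scaleR_component
          add: sum_distrib_left sum_distrib_right sc mult_ac sum_negf)
    finally show ?thesis .
  qed
  then show ?thesis by (simp add: vec_eq_iff)
qed

lemma damped_equation_iff:
  "X = A + B ** (r *\<^sub>R X) ** hermitian_adjoint B
    \<longleftrightarrow> damped_system B r *v flatten_matrix X = flatten_matrix A"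
  by (auto simp: damped_system_flatten flatten_matrix_inject algebra_simps)

text \<open>A kernel vector, reshaped into a matrix, solves the damped equation with source 0 and
  therefore vanishes.\<close>

lemma det_damped_system_nonzero:
  assumes "contraction B" "0 \<le> r" "r < 1"
  shows "det (damped_system B r) \<noteq> 0"
proof -
  have "x = 0" if "damped_system B r *v x = 0" for x
  proof -
    define Y where "Y = (\<chi> i j. x $ (i, j))"
    have x: "x = flatten_matrix Y" by (simp add: Y_def flatten_matrix_def vec_eq_iff)
    have 0: "(0 :: complex^('a \<times> 'a)) = flatten_matrix 0" by (simp add: flatten_matrix_def vec_eq_iff)
    have "Y = 0 + B ** (r *\<^sub>R Y) ** hermitian_adjoint B"
      using that by (subst damped_equation_iff) (simp flip: x 0)
    then have "Y = 0" using damped_stationary_eq_0[OF assms] by simp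
    then show ?thesis using x 0 by simp
  qed
  then have "\<exists>M. M ** damped_system B r = mat 1"
    using matrix_left_invertible_ker by blast
  then show ?thesis by (simp add: invertible_left_inverse flip: invertible_det_nz)
qed

definition damped_solution_matrix :: "complex^'m^'m::finite \<Rightarrow> complex^'m^'m \<Rightarrow> real \<Rightarrow> complex^'m^'m"
  where "damped_solution_matrix A B r =
    (\<chi> a b. damped_numerator A B (a, b) r / det (damped_system B r))"

lemma damped_solution_matrix:
  assumes "contraction B" "0 \<le> r" "r < 1"
  shows "damped_solution_matrix A B r
    = A + B ** (r *\<^sub>R damped_solution_matrix A B r) ** hermitian_adjoint B"
  unfolding damped_equation_iff cramer[OF det_damped_system_nonzero[OF assms]]
  by (simp add: damped_solution_matrix_def flatten_matrix_def[of "\<chi> a b. _ a b"] damped_numerator_def)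

text \<open>The quotient is an entry of a contraction. Multiplied out, the bound allows the orders
  of vanishing at r = 1 to be compared.\<close>

lemma damped_numerator_le:
  assumes "contractive_pair A B" "0 \<le> r" "r < 1"
  shows "norm (damped_numerator A B p r) \<le> norm (det (damped_system B r))"
proof -
  have B: "contraction B" using assms by (simp add: contractive_pair_def)
  have "contraction (damped_solution_matrix A B r)"
    using damped_solution(1)[OF assms damped_solution_matrix[OF B assms(2,3)]] .
  from contraction_entry_le[OF this, of "fst p" "snd p"] det_damped_system_nonzero[OF B assms(2,3)]
  show ?thesis by (simp add: damped_solution_matrix_def norm_divide field_simps)
qed

lemma dissipative_steady_state_entry_limit:
  assumes "contractive_pair A B"
    and "\<And>p. ((\<lambda>r. damped_numerator A B p r / det (damped_system B r)) \<longlongrightarrow> L p) (at_left 1)"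
  shows "dissipative_steady_state A B = (\<chi> a b. L (a, b))"
proof (rule dissipative_steady_state_limit[OF assms(1)])
  have B: "contraction B" using assms by (simp add: contractive_pair_def)
  show "damped_solution_matrix A B r
    = A + B ** (r *\<^sub>R damped_solution_matrix A B r) ** hermitian_adjoint B" if "0 \<le> r" "r < 1" for r
    using damped_solution_matrix[OF B that] .
  show "(damped_solution_matrix A B \<longlongrightarrow> (\<chi> a b. L (a, b))) (at_left 1)"
    by (intro vec_tendstoI) (simp add: damped_solution_matrix_def assms(2))
qed

subsection \<open>Laurent polynomials on the unit circle\<close>

text \<open>The damping is a variable of its own because the limit r \<rightarrow> 1 is analysed
  algebraically.\<close>

inductive trig_poly :: "(real \<Rightarrow> real \<Rightarrow> complex) \<Rightarrow> bool" where
  const: "trig_poly (\<lambda>r k. c)"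
| damping: "trig_poly (\<lambda>r k. of_real r)"
| cis: "trig_poly (\<lambda>r k. cis k)"
| cis_minus: "trig_poly (\<lambda>r k. cis (- k))"
| add: "trig_poly f \<Longrightarrow> trig_poly g \<Longrightarrow> trig_poly (\<lambda>r k. f r k + g r k)"
| mult: "trig_poly f \<Longrightarrow> trig_poly g \<Longrightarrow> trig_poly (\<lambda>r k. f r k * g r k)"

lemma trig_poly_cnj: "trig_poly f \<Longrightarrow> trig_poly (\<lambda>r k. cnj (f r k))"
proof (induction rule: trig_poly.induct)
  case cis then show ?case using trig_poly.cis_minus by (simp add: cis_cnj)
next
  case cis_minus then show ?case using trig_poly.cis by (simp add: cis_cnj)
qed (auto intro: trig_poly.intros)

lemma trig_poly_If:
  "trig_poly f \<Longrightarrow> trig_poly g \<Longrightarrow> trig_poly (\<lambda>r k. if P then f r k else g r k)"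
  by (cases P) simp_all

lemma trig_poly_sum:
  assumes "\<And>i. i \<in> I \<Longrightarrow> trig_poly (f i)"
  shows "trig_poly (\<lambda>r k. \<Sum>i\<in>I. f i r k)"
  using assms by (induction I rule: infinite_finite_induct) (auto intro: trig_poly.intros)

lemma trig_poly_prod:
  assumes "\<And>i. i \<in> I \<Longrightarrow> trig_poly (f i)"
  shows "trig_poly (\<lambda>r k. \<Prod>i\<in>I. f i r k)"
  using assms by (induction I rule: infinite_finite_induct) (auto intro: trig_poly.intros)

lemma trig_poly_det:
  fixes M :: "real \<Rightarrow> real \<Rightarrow> complex^'n^'n"
  assumes "\<And>i j. trig_poly (\<lambda>r k. M r k $ i $ j)"
  shows "trig_poly (\<lambda>r k. det (M r k))"
  unfolding det_def by (intro trig_poly_sum trig_poly_prod trig_poly.mult trig_poly.const assms)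

text \<open>A power of e^(ik) clears the negative exponents. The outer variable of \<open>p\<close>
  is the damping and its coefficients are polynomials in e^(ik), whence the evaluation at the
  constant polynomial \<open>[:of_real r:]\<close>.\<close>

lemma trig_poly_representation:
  assumes "trig_poly f"
  shows "\<exists>J p. \<forall>r k. cis k ^ J * f r k = poly (poly p [:of_real r:]) (cis k)"
  using assms
proof (induction rule: trig_poly.induct)
  case (const c)
  show ?case by (rule exI[of _ 0], rule exI[of _ "[:[:c:]:]"]) simp
next
  case damping
  show ?case by (rule exI[of _ 0], rule exI[of _ "[:0, 1:]"]) simp
next
  case cis
  show ?case by (rule exI[of _ 0], rule exI[of _ "[:[:0, 1:]:]"]) simp
next
  case cis_minus
  show ?case by (rule exI[of _ 1], rule exI[of _ 1]) (simp add: cis_mult)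
next
  case (add f g)
  then obtain J p K q where
    "\<And>r k. cis k ^ J * f r k = poly (poly p [:of_real r:]) (cis k)"
    "\<And>r k. cis k ^ K * g r k = poly (poly q [:of_real r:]) (cis k)" by metis
  then show ?case
    by (intro exI[of _ "J + K"] exI[of _ "[:monom 1 K:] * p + [:monom 1 J:] * q"])
       (simp add: poly_monom power_add algebra_simps)
next
  case (mult f g)
  then obtain J p K q where
    *: "\<And>r k. cis k ^ J * f r k = poly (poly p [:of_real r:]) (cis k)"
    "\<And>r k. cis k ^ K * g r k = poly (poly q [:of_real r:]) (cis k)" by metis
  show ?case
    by (intro exI[of _ "J + K"] exI[of _ "p * q"])
       (simp add: power_add algebra_simps flip: *)
qed

section \<open>Momentum-space data as matrices of trigonometric polynomials\<close>

definition trig_matrix :: "(real \<Rightarrow> complex^'n^'m) \<Rightarrow> bool"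
  where "trig_matrix F \<longleftrightarrow> (\<forall>i j. trig_poly (\<lambda>r k. F k $ i $ j))"

lemma trig_matrix_const: "trig_matrix (\<lambda>k. M)"
  by (simp add: trig_matrix_def trig_poly.const)

lemma trig_matrix_add: "trig_matrix F \<Longrightarrow> trig_matrix G \<Longrightarrow> trig_matrix (\<lambda>k. F k + G k)"
  by (simp add: trig_matrix_def trig_poly.add)

lemma trig_matrix_mult: "trig_matrix F \<Longrightarrow> trig_matrix G \<Longrightarrow> trig_matrix (\<lambda>k. F k ** G k)"
  by (simp add: trig_matrix_def matrix_matrix_mult_def trig_poly_sum trig_poly.mult)

lemma trig_matrix_adjoint: "trig_matrix F \<Longrightarrow> trig_matrix (\<lambda>k. hermitian_adjoint (F k))"
  by (simp add: trig_matrix_def hermitian_adjoint_def transpose_def trig_poly_cnj)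

lemma trig_matrix_shift_matrix: "trig_matrix shift_matrix"
proof -
  have e: "exp (- (\<i> * complex_of_real k)) = cis (- k)" for k
    by (simp add: cis_conv_exp)
  have "trig_poly (\<lambda>r k. shift_matrix k $ i $ j)" for i j :: "'a + 'a"
    by (cases i; cases j) (auto simp: shift_matrix_def block_matrix_def mat_def e
        intro!: trig_poly_If trig_poly.const trig_poly.cis_minus)
  then show ?thesis by (simp add: trig_matrix_def)
qed

lemma trig_matrix_momentum_even: "trig_matrix (momentum_even M)"
  unfolding momentum_even_def[abs_def]
  by (intro trig_matrix_mult trig_matrix_adjoint trig_matrix_const trig_matrix_shift_matrix)

lemma trig_matrix_period_B: "trig_matrix (period_B Bo Be)"
  unfolding period_B_def[abs_def]
  by (intro trig_matrix_mult trig_matrix_const trig_matrix_momentum_even)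

lemma trig_matrix_period_A: "trig_matrix (period_A Ao Ae Be)"
  unfolding period_A_def[abs_def]
  by (intro trig_matrix_add trig_matrix_mult trig_matrix_const trig_matrix_momentum_even)

lemma trig_poly_damped_system:
  assumes "trig_matrix B"
  shows "trig_poly (\<lambda>r k. damped_system (B k) r $ p $ q)"
proof -
  have "trig_poly (\<lambda>r k. of_real (- r))"
    using trig_poly.mult[OF trig_poly.const[of "-1"] trig_poly.damping] by simp
  moreover have "damped_system (B k) r $ p $ q = (if p = q then 1 else 0)
      + of_real (- r) * (B k $ fst p $ fst q * cnj (B k $ snd p $ snd q))" for r k
    by (simp add: damped_system_def)
  ultimately show ?thesis
    using assms unfolding trig_matrix_def
    by (simp only:) (intro trig_poly.add trig_poly.mult trig_poly_If trig_poly.const trig_poly_cnj; blast)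
qed

lemma trig_poly_det_damped_system:
  assumes "trig_matrix B"
  shows "trig_poly (\<lambda>r k. det (damped_system (B k) r))"
  by (intro trig_poly_det trig_poly_damped_system assms)

lemma trig_poly_damped_numerator:
  assumes "trig_matrix A" "trig_matrix B"
  shows "trig_poly (\<lambda>r k. damped_numerator (A k) (B k) p r)"
  unfolding damped_numerator_def
proof (rule trig_poly_det)
  fix i j
  show "trig_poly (\<lambda>r k. (\<chi> i j. if j = p then flatten_matrix (A k) $ i
      else damped_system (B k) r $ i $ j) $ i $ j)"
    using assms(1) trig_poly_damped_system[OF assms(2)]
    by (cases "j = p") (auto simp: flatten_matrix_def trig_matrix_def)
qed

subsection \<open>Removing the poles of a bounded limit\<close>

text \<open>Needed for limits along the circle; a connected set with more than one point has no
  isolated points.\<close>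

lemma islimpt_circle:
  assumes "z \<in> range cis"
  shows "z islimpt range cis"
proof (rule connected_imp_perfect[OF _ assms])
  show "connected (range cis)"
    by (intro connected_continuous_image continuous_intros) auto
  show "range cis \<noteq> {x}" for x
  proof
    assume "range cis = {x}"
    then have "cis 0 = cis pi" by (metis rangeI singletonD)
    then show False by (simp add: complex_eq_iff)
  qed
qed

lemma infinite_circle: "infinite (range cis)"
  using islimpt_circle[of "cis 0"] islimpt_finite by blast

text \<open>A denominator of minimal degree cannot vanish on the circle: by the bound the numerator
  would vanish at the same point, and a common factor could be cancelled.\<close>

lemma bounded_quotient_reduce:
  fixes n d :: "complex poly"
  assumes "finite Z" "d \<noteq> 0"
    and le: "\<And>k. cis k \<notin> Z \<Longrightarrow> norm (poly n (cis k)) \<le> norm (poly d (cis k))"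
  shows "\<exists>n' d'. (\<forall>k. poly d' (cis k) \<noteq> 0) \<and> n * d' = n' * d"
proof -
  \<comment> \<open>\<open>Q d'\<close> says that the fraction \<open>n / d\<close> can be written
    with denominator \<open>d'\<close>.\<close>
  define Q where "Q = (\<lambda>d'. d' \<noteq> 0 \<and> (\<exists>n'. n * d' = n' * d))"
  have "Q d" using assms by (auto simp: Q_def)
  define e where "e = (ARG_MIN degree x. Q x)"
  have e: "Q e" "\<And>x. Q x \<Longrightarrow> degree e \<le> degree x"
    using arg_min_nat_lemma[of Q d degree] \<open>Q d\<close> by (auto simp: e_def)
  then obtain m where m: "n * e = m * d" and e0: "e \<noteq> 0" by (auto simp: Q_def)
  have "poly e (cis k) \<noteq> 0" for k
  proof
    assume zero: "poly e (cis k) = 0"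
    let ?F = "at (cis k) within range cis"
    have nt: "\<not> trivial_limit ?F"
      using islimpt_circle[of "cis k"] by (simp add: trivial_limit_within)
    \<comment> \<open>The roots of \<open>d\<close> are avoided as well, since \<open>d\<close> is
      cancelled below. The point \<open>cis k\<close> may itself lie in this set, because the filter
      omits it.\<close>
    let ?Z = "Z \<union> {z. poly d z = 0}"
    have fin: "finite ?Z" using assms poly_roots_finite by auto
    have "open (- (?Z - {cis k}))"
      by (intro open_Compl finite_imp_closed finite_Diff fin)
    then have "eventually (\<lambda>z. z \<in> - (?Z - {cis k})) (nhds (cis k))"
      by (rule eventually_nhds_in_open) simp
    then have "eventually (\<lambda>z. norm (poly m z) \<le> norm (poly e z)) ?F"
      unfolding eventually_at_filter
    proof (rule eventually_mono, intro impI)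
      fix z assume z: "z \<in> - (?Z - {cis k})" "z \<noteq> cis k" "z \<in> range cis"
      then have d: "poly d z \<noteq> 0" and "z \<notin> Z" by auto
      then have "norm (poly n z) \<le> norm (poly d z)" using le z(3) by auto
      then have "norm (poly n z * poly e z) \<le> norm (poly d z) * norm (poly e z)"
        by (simp add: norm_mult mult_right_mono)
      also have "poly n z * poly e z = poly m z * poly d z"
        using arg_cong[OF m, of "\<lambda>p. poly p z"] by simp
      finally show "norm (poly m z) \<le> norm (poly e z)"
        using d by (simp add: norm_mult)
    qed
    moreover have "((\<lambda>z. norm (poly m z)) \<longlongrightarrow> norm (poly m (cis k))) ?F"
      "((\<lambda>z. norm (poly e z)) \<longlongrightarrow> norm (poly e (cis k))) ?F"
      by (intro tendsto_intros)+
    ultimately have "norm (poly m (cis k)) \<le> norm (poly e (cis k))"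
      using tendsto_le[OF nt] by blast
    then have "poly m (cis k) = 0" using zero by simp
    then obtain m' e' where m': "m = [:- cis k, 1:] * m'" and e': "e = [:- cis k, 1:] * e'"
      using zero by (metis dvdE poly_eq_0_iff_dvd)
    have "[:- cis k, 1:] * (n * e') = [:- cis k, 1:] * (m' * d)"
      using m unfolding m' e' by (simp only: mult_ac)
    then have "n * e' = m' * d" by (simp only: mult_cancel_left) auto
    then have "Q e'" using e0 e' by (auto simp: Q_def)
    then have "degree e \<le> degree e'" by (rule e(2))
    moreover have "degree e = Suc (degree e')"
      unfolding e' using e0 e' by (subst degree_mult_eq) auto
    ultimately show False by simp
  qed
  then show ?thesis using m by blast
qed

lemma tendsto_poly_poly:
  fixes p :: "complex poly poly"
  shows "((\<lambda>r. poly (poly p [:of_real r:]) z) \<longlongrightarrow> poly (poly p 1) z) (at_left 1)"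
proof (induction p)
  case (pCons a p)
  have "((\<lambda>r. poly a z + of_real r * poly (poly p [:of_real r:]) z)
      \<longlongrightarrow> poly a z + of_real 1 * poly (poly p 1) z) (at_left 1)"
    by (intro tendsto_intros pCons)
  then show ?case by simp
qed simp

lemma poly_factor_at_1:
  fixes p :: "complex poly poly"
  assumes "p \<noteq> 0"
  obtains a q where "p = [:- 1, 1:] ^ a * q" "poly q 1 \<noteq> 0"
  using order_decomp[OF assms, of 1] by (auto simp: poly_eq_0_iff_dvd)

text \<open>Both polynomials are divided by their powers of \<open>r - 1\<close>; the bound forces the
  exponent of the numerator to be at least that of the denominator.\<close>

lemma poly_poly_quotient_limit:
  fixes n d :: "complex poly poly"
  assumes nz: "\<And>r k. 0 \<le> r \<Longrightarrow> r < 1 \<Longrightarrow> poly (poly d [:of_real r:]) (cis k) \<noteq> 0"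
    and le: "\<And>r k. 0 \<le> r \<Longrightarrow> r < 1 \<Longrightarrow>
      norm (poly (poly n [:of_real r:]) (cis k)) \<le> norm (poly (poly d [:of_real r:]) (cis k))"
  shows "\<exists>n' d' Z. finite Z \<and> (\<forall>k. poly d' (cis k) \<noteq> 0) \<and>
    (\<forall>k. cis k \<notin> Z \<longrightarrow>
      ((\<lambda>r. poly (poly n [:of_real r:]) (cis k) / poly (poly d [:of_real r:]) (cis k))
        \<longlongrightarrow> poly n' (cis k) / poly d' (cis k)) (at_left 1))"
proof (cases "n = 0")
  case True
  then show ?thesis by (intro exI[of _ 0] exI[of _ 1] exI[of _ "{}"]) simp
next
  case False
  have ev: "eventually (\<lambda>r. 0 \<le> r \<and> r < 1) (at_left (1::real))"
    using eventually_at_left_real[of 0 1] by (auto elim: eventually_mono)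
  have "d \<noteq> 0" using nz[of 0 0] by auto
  then obtain a d1 where d1: "d = [:- 1, 1:] ^ a * d1" "poly d1 1 \<noteq> 0" by (rule poly_factor_at_1)
  obtain b n1 where n1: "n = [:- 1, 1:] ^ b * n1" "poly n1 1 \<noteq> 0"
    using poly_factor_at_1[OF False] .
  define ev1 where "ev1 = (\<lambda>(p :: complex poly poly) k r. poly (poly p [:of_real r:]) (cis k))"
  have fac: "ev1 ([:- 1, 1:] ^ c * p) k r = (of_real r - 1) ^ c * ev1 p k r" for c p k r
    by (simp add: ev1_def)
  have lim: "(ev1 p k \<longlongrightarrow> poly (poly p 1) (cis k)) (at_left 1)" for p k
    unfolding ev1_def by (rule tendsto_poly_poly)
  have lim1: "((\<lambda>r. (of_real r - 1 :: complex) ^ c) \<longlongrightarrow> 0 ^ c) (at_left 1)" for c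
    by (rule tendsto_eq_intros refl | simp)+
  \<comment> \<open>Off this finite set neither cofactor vanishes at r = 1.\<close>
  let ?Z = "{z. poly (poly d1 1) z = 0} \<union> {z. poly (poly n1 1) z = 0}"
  have fin: "finite ?Z" using d1(2) n1(2) poly_roots_finite by auto
  have le1: "norm ((of_real r - 1) ^ b * ev1 n1 k r) \<le> norm ((of_real r - 1) ^ a * ev1 d1 k r)"
    if "0 \<le> r" "r < 1" for r k
    using le[OF that, of k] unfolding fac[symmetric] d1(1)[symmetric] n1(1)[symmetric] unfolding ev1_def .
  have ab: "a \<le> b"
  proof (rule ccontr)
    assume "\<not> a \<le> b"
    then obtain c where c: "a = b + Suc c" using less_imp_Suc_add by fastforce
    have "\<not> range cis \<subseteq> ?Z" using fin infinite_circle finite_subset by blast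
    then obtain k where k: "cis k \<notin> ?Z" by blast
    have le2: "norm (ev1 n1 k r) \<le> norm ((of_real r - 1) ^ Suc c * ev1 d1 k r)"
      if "0 \<le> r" "r < 1" for r
    proof -
      have "norm ((of_real r - 1 :: complex) ^ b) > 0" using that by auto
      moreover have "norm ((of_real r - 1 :: complex) ^ b) * norm (ev1 n1 k r)
          \<le> norm ((of_real r - 1 :: complex) ^ b) * norm ((of_real r - 1) ^ Suc c * ev1 d1 k r)"
        using le1[OF that, of k] by (simp add: c norm_mult power_add mult_ac)
      ultimately show ?thesis by (simp only: mult_le_cancel_left_pos)
    qed
    \<comment> \<open>The right-hand side is 0, while \<open>k\<close> was chosen so that the
      left-hand side is positive.\<close>
    have "norm (poly (poly n1 1) (cis k)) \<le> norm (0 ^ Suc c * poly (poly d1 1) (cis k))"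
    proof (rule tendsto_le)
      show "((\<lambda>r. norm ((of_real r - 1) ^ Suc c * ev1 d1 k r)) \<longlongrightarrow>
        norm (0 ^ Suc c * poly (poly d1 1) (cis k))) (at_left 1)"
        by (intro tendsto_norm tendsto_mult lim lim1)
      show "((\<lambda>r. norm (ev1 n1 k r)) \<longlongrightarrow> norm (poly (poly n1 1) (cis k))) (at_left 1)"
        by (intro tendsto_norm lim)
      show "eventually (\<lambda>r. norm (ev1 n1 k r) \<le> norm ((of_real r - 1) ^ Suc c * ev1 d1 k r)) (at_left 1)"
        using ev by eventually_elim (use le2 in auto)
    qed simp
    then show False using k by simp
  qed
  \<comment> \<open>The factor \<open>0 ^ (b - a)\<close>, the limit of (r - 1)^(b - a), is 1 for
    equal orders and 0 otherwise.\<close>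
  define m where "m = smult (0 ^ (b - a)) (poly n1 1)"
  have limit: "((\<lambda>r. ev1 n k r / ev1 d k r) \<longlongrightarrow> poly m (cis k) / poly (poly d1 1) (cis k)) (at_left 1)"
    if "cis k \<notin> ?Z" for k
  proof -
    have "((\<lambda>r. (of_real r - 1) ^ (b - a) * ev1 n1 k r / ev1 d1 k r) \<longlongrightarrow>
       0 ^ (b - a) * poly (poly n1 1) (cis k) / poly (poly d1 1) (cis k)) (at_left 1)"
      by (intro tendsto_intros lim lim1) (use that in auto)
    moreover have "eventually (\<lambda>r. (of_real r - 1) ^ (b - a) * ev1 n1 k r / ev1 d1 k r
        = ev1 n k r / ev1 d k r) (at_left 1)"
      using ev
    proof eventually_elim
      case (elim r)
      then have "(of_real r - 1 :: complex) ^ a \<noteq> 0" by auto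
      moreover have "(of_real r - 1 :: complex) ^ b
          = (of_real r - 1) ^ a * (of_real r - 1) ^ (b - a)"
        using ab by (simp flip: power_add)
      moreover have "r \<noteq> 1" using elim by simp
      ultimately show ?case by (simp add: d1(1) n1(1) fac)
    qed
    ultimately show ?thesis unfolding m_def by (simp add: Lim_transform_eventually)
  qed
  \<comment> \<open>The bound survives the limit, so zeros of the limiting denominator on the circle
    can be cancelled.\<close>
  have "norm (poly m (cis k)) \<le> norm (poly (poly d1 1) (cis k))" if k: "cis k \<notin> ?Z" for k
  proof -
    have "norm (poly m (cis k) / poly (poly d1 1) (cis k)) \<le> 1"
    proof (rule tendsto_upperbound[OF tendsto_norm[OF limit[OF k]]])
      show "eventually (\<lambda>r. norm (ev1 n k r / ev1 d k r) \<le> 1) (at_left 1)"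
        using ev
      proof eventually_elim
        case (elim r)
        then show ?case
          using le[of r k] nz[of r k] by (simp add: ev1_def norm_divide)
      qed
    qed simp
    then show ?thesis using k by (simp add: norm_divide)
  qed
  then obtain n' d' where d': "\<And>k. poly d' (cis k) \<noteq> 0" and eq: "m * d' = n' * poly d1 1"
    using bounded_quotient_reduce[OF fin d1(2)] by metis
  have "poly m (cis k) / poly (poly d1 1) (cis k) = poly n' (cis k) / poly d' (cis k)"
    if "cis k \<notin> ?Z" for k
    using arg_cong[OF eq, of "\<lambda>p. poly p (cis k)"] d'[of k] that by (simp add: field_simps)
  then show ?thesis
    using limit fin d' unfolding ev1_def by (intro exI[of _ n'] exI[of _ d'] exI[of _ ?Z]) auto
qed

lemma trig_poly_quotient_limit:
  assumes "trig_poly N" "trig_poly D"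
    and nz: "\<And>r k. 0 \<le> r \<Longrightarrow> r < 1 \<Longrightarrow> D r k \<noteq> 0"
    and le: "\<And>r k. 0 \<le> r \<Longrightarrow> r < 1 \<Longrightarrow> norm (N r k) \<le> norm (D r k)"
  shows "\<exists>n d Z. finite Z \<and> (\<forall>k. poly d (cis k) \<noteq> 0) \<and>
    (\<forall>k. cis k \<notin> Z \<longrightarrow>
      ((\<lambda>r. N r k / D r k) \<longlongrightarrow> poly n (cis k) / poly d (cis k)) (at_left 1))"
proof -
  obtain J p K q where
    p: "\<And>r k. cis k ^ J * N r k = poly (poly p [:of_real r:]) (cis k)" and
    q: "\<And>r k. cis k ^ K * D r k = poly (poly q [:of_real r:]) (cis k)"
    using trig_poly_representation assms(1,2) by metis
  \<comment> \<open>Each polynomial also receives the power that cleared the other function. The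
    common factor \<open>cis k ^ (J + K)\<close> has modulus 1, so it keeps the bound and cancels in
    the quotient.\<close>
  let ?p = "[:monom 1 K:] * p" and ?q = "[:monom 1 J:] * q"
  have p': "poly (poly ?p [:of_real r:]) (cis k) = cis k ^ (J + K) * N r k" for r k
    by (simp add: poly_monom power_add mult_ac flip: p)
  have q': "poly (poly ?q [:of_real r:]) (cis k) = cis k ^ (J + K) * D r k" for r k
    by (simp add: poly_monom power_add mult_ac flip: q)
  have "cis k ^ (J + K) * N r k / (cis k ^ (J + K) * D r k) = N r k / D r k" for r k
    by simp
  then show ?thesis
    using poly_poly_quotient_limit[of ?q ?p] nz le unfolding p' q'
    by (simp add: norm_mult norm_power)
qed

subsection \<open>Exponential decay of Fourier coefficients\<close>

text \<open>The contour is moved from the unit circle to a circle of radius \<open>1 - \<delta>\<close> or \<open>1 + \<delta>\<close>,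
  according to the sign of \<open>x\<close>.\<close>

lemma fourier_coefficient_decay:
  fixes n d :: "complex poly"
  assumes d: "\<And>k. poly d (cis k) \<noteq> 0"
  shows "\<exists>C \<xi>. C > 0 \<and> \<xi> > 0 \<and> (\<forall>x::int.
    norm (integral {-pi..pi} (\<lambda>k. cis k powi x * (poly n (cis k) / poly d (cis k))))
      \<le> C * exp (- \<bar>real_of_int x\<bar> / \<xi>))"
proof -
  have "d \<noteq> 0" using d[of 0] by auto
  \<comment> \<open>Distances of the roots of \<open>d\<close> from the unit circle; the extra 1/2
    makes the set nonempty and keeps the annulus away from 0.\<close>
  define R where "R = insert (1/2) ((\<lambda>z. \<bar>norm z - 1\<bar>) ` {z. poly d z = 0})"
  have finR: "finite R" using poly_roots_finite[OF \<open>d \<noteq> 0\<close>] by (simp add: R_def)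
  have unit: "poly d z \<noteq> 0" if "norm z = 1" for z
    using d[of "Arg z"] that rcis_cmod_Arg[of z] by (simp add: rcis_def)
  have posR: "x > 0" if "x \<in> R" for x using that unit by (auto simp: R_def)
  define \<delta> where "\<delta> = Min R / 2"
  have "Min R > 0" using finR posR by (subst Min_gr_iff) (auto simp: R_def)
  then have \<delta>0: "\<delta> > 0" by (simp add: \<delta>_def)
  have "Min R \<le> 1/2" using finR by (intro Min_le) (auto simp: R_def)
  then have \<delta>1: "\<delta> \<le> 1/4" by (simp add: \<delta>_def)
  define S where "S = {z::complex. 1 - 2 * \<delta> < norm z \<and> norm z < 1 + 2 * \<delta>}"
  have dS: "poly d z \<noteq> 0" if "z \<in> S" for z
  proof
    assume "poly d z = 0"
    then have "Min R \<le> \<bar>norm z - 1\<bar>" using finR by (intro Min_le) (auto simp: R_def)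
    then show False using that by (auto simp: S_def \<delta>_def)
  qed
  have "open S"
    unfolding S_def by (intro open_Collect_conj open_Collect_less continuous_intros)
  define f where "f = (\<lambda>z. poly n z / poly d z)"
  have holf: "f holomorphic_on S"
    unfolding f_def using dS by (intro holomorphic_intros) auto
  define T where "T = cball (0::complex) (1 + \<delta>) - ball 0 (1 - \<delta>)"
  have TS: "T \<subseteq> S" using \<delta>0 by (auto simp: T_def S_def)
  have "compact T" unfolding T_def by (intro compact_diff compact_cball open_ball)
  then have "compact (f ` T)"
    using holomorphic_on_imp_continuous_on[OF holf] TS continuous_on_subset
    by (intro compact_continuous_image) auto
  then obtain M where M: "M > 0" "\<And>z. z \<in> T \<Longrightarrow> norm (f z) \<le> M"
    using bounded_pos compact_imp_bounded by (metis image_eqI)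
  \<comment> \<open>One power less than in the Fourier integral, because dz = \<i> z dk on the unit
    circle.\<close>
  define F where "F = (\<lambda>(x::int) z. z powi (x - 1) * f z)"
  have S0: "0 \<notin> S" using \<delta>1 by (auto simp: S_def)
  have holF: "F x holomorphic_on S" for x
    unfolding F_def using holf S0 by (intro holomorphic_intros) auto
  have norm_pc: "norm (part_circlepath 0 s (-pi) pi t) = s" if "s \<ge> 0" for s t
    using that by (simp add: part_circlepath_def norm_mult)
  have bound: "norm (contour_integral (part_circlepath 0 1 (-pi) pi) (F x)) \<le> 2 * pi * M * s powi x"
    if s: "s \<in> {1 - \<delta>..1 + \<delta>}" for x s
  proof -
    let ?g = "part_circlepath 0 s (-pi) pi"
    have s0: "s > 0" using s \<delta>1 by auto
    \<comment> \<open>Corresponding points of the two circles share their angle, so along the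
      joining segment the radius runs from 1 to \<open>s\<close> and stays inside the
      annulus.\<close>
    have "homotopic_loops S (part_circlepath 0 1 (-pi) pi) ?g"
    proof (rule homotopic_loops_linear)
      fix t :: real
      show "closed_segment (part_circlepath 0 1 (-pi) pi t) (?g t) \<subseteq> S"
      proof
        fix w assume "w \<in> closed_segment (part_circlepath 0 1 (-pi) pi t) (?g t)"
        then obtain u where u: "0 \<le> u" "u \<le> 1"
          "w = (1 - u) *\<^sub>R part_circlepath 0 1 (-pi) pi t + u *\<^sub>R ?g t"
          by (auto simp: closed_segment_def)
        then have w: "w = part_circlepath 0 ((1 - u) + u * s) (-pi) pi t"
          by (simp add: part_circlepath_def scaleR_conv_of_real algebra_simps)
        have "norm w = (1 - u) + u * s" using u s0 unfolding w by (intro norm_pc) auto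
        moreover have "u * (1 - \<delta>) \<le> u * s" "u * s \<le> u * (1 + \<delta>)"
          using u s by (auto intro!: mult_left_mono)
        then have "u - u * \<delta> \<le> u * s" "u * s \<le> u + u * \<delta>"
          unfolding right_diff_distrib distrib_left by simp_all
        moreover have "u * \<delta> \<le> 1 * \<delta>" using u \<delta>0 by (intro mult_right_mono) auto
        ultimately have "1 - 2 * \<delta> < norm w" "norm w < 1 + 2 * \<delta>" using \<delta>0 by linarith+
        then show "w \<in> S" by (simp add: S_def)
      qed
    qed (auto simp: exp_minus exp_pi_i)
    then have "contour_integral (part_circlepath 0 1 (-pi) pi) (F x) = contour_integral ?g (F x)"
      using Cauchy_theorem_homotopic_loops[OF _ \<open>open S\<close> holF] by simp
    also have "norm \<dots> \<le> (s powi (x - 1) * M) * s * \<bar>pi - - pi\<bar>"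
    proof (rule contour_integral_bound_part_circlepath)
      have im: "z \<in> T \<and> norm z = s" if "z \<in> path_image ?g" for z
        using that s s0 norm_pc[of s] by (auto simp: path_image_def T_def)
      show "F x contour_integrable_on ?g"
        using im TS by (intro contour_integrable_holomorphic_simple[OF holF \<open>open S\<close>]) auto
      show "norm (F x z) \<le> s powi (x - 1) * M" if "z \<in> path_image ?g" for z
        using im[OF that] M(2)[of z] s0 by (simp add: F_def norm_mult norm_power_int mult_left_mono)
    qed (use s0 M in auto)
    also have "\<dots> = 2 * pi * M * s powi x"
      using s0 by (simp add: power_int_diff)
    finally show ?thesis .
  qed
  have int: "norm (integral {-pi..pi} (\<lambda>k. cis k powi x * (poly n (cis k) / poly d (cis k))))
      = norm (contour_integral (part_circlepath 0 1 (-pi) pi) (F x))" for x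
  proof -
    have "contour_integral (part_circlepath 0 1 (-pi) pi) (F x)
        = integral {-pi..pi} (\<lambda>k. \<i> * (cis k powi x * (poly n (cis k) / poly d (cis k))))"
      by (subst contour_integral_part_circlepath_eq)
         (auto simp: F_def f_def power_int_diff intro!: integral_cong)
    also have "\<dots> = \<i> * integral {-pi..pi} (\<lambda>k. cis k powi x * (poly n (cis k) / poly d (cis k)))"
      by (simp only: integral_mult_right)
    finally show ?thesis by (simp add: norm_mult)
  qed
  have ln: "ln (1 + \<delta>) > 0" using \<delta>0 by simp
  have "norm (integral {-pi..pi} (\<lambda>k. cis k powi x * (poly n (cis k) / poly d (cis k))))
      \<le> (2 * pi * M) * exp (- \<bar>real_of_int x\<bar> / (1 / ln (1 + \<delta>)))" for x
  proof -
    have e: "exp (- \<bar>real_of_int x\<bar> / (1 / ln (1 + \<delta>))) = (1 + \<delta>) powi (- \<bar>x\<bar>)"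
      using \<delta>0 by (simp add: powr_def flip: powr_real_of_int')
    \<comment> \<open>The inner radius serves \<open>x \<ge> 0\<close>, the outer one
      \<open>x < 0\<close>; since (1 - \<delta>) (1 + \<delta>) \<le> 1, the rate
      \<open>ln (1 + \<delta>)\<close> works for both.\<close>
    have "\<exists>s\<in>{1 - \<delta>..1 + \<delta>}. s powi x \<le> (1 + \<delta>) powi (- \<bar>x\<bar>)"
    proof (cases "x \<ge> 0")
      case True
      then obtain m where m: "x = int m" using nonneg_int_cases by blast
      have "(1 - \<delta>) * (1 + \<delta>) \<le> 1" by (simp add: algebra_simps)
      then have "1 - \<delta> \<le> inverse (1 + \<delta>)" using \<delta>0 by (simp add: field_simps)
      then have "(1 - \<delta>) ^ m \<le> inverse (1 + \<delta>) ^ m" using \<delta>1 by (intro power_mono) auto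
      then show ?thesis using \<delta>0
        by (intro bexI[of _ "1 - \<delta>"]) (auto simp: m power_int_minus power_inverse)
    next
      case False
      then show ?thesis using \<delta>0 by (intro bexI[of _ "1 + \<delta>"]) auto
    qed
    then obtain s where s: "s \<in> {1 - \<delta>..1 + \<delta>}" "s powi x \<le> (1 + \<delta>) powi (- \<bar>x\<bar>)" by blast
    have "2 * pi * M * s powi x \<le> 2 * pi * M * (1 + \<delta>) powi (- \<bar>x\<bar>)"
      using s(2) M(1) by (intro mult_left_mono) auto
    then show ?thesis unfolding int e using bound[OF s(1), of x] by linarith
  qed
  then show ?thesis
    using M(1) ln by (intro exI[of _ "2 * pi * M"] exI[of _ "1 / ln (1 + \<delta>)"]) auto
qed

subsection \<open>Contractivity in momentum space\<close>

lemma sum_UNIV_sum_type: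
  "(\<Sum>i\<in>(UNIV :: ('p::finite + 'q::finite) set). f i) = (\<Sum>i\<in>UNIV. f (Inl i)) + (\<Sum>i\<in>UNIV. f (Inr i))"
  by (simp add: sum.Plus flip: UNIV_Plus_UNIV)

text \<open>The Loewner inequality says that \<open>channel_matrix A B\<close> does not increase
  norms; it is evaluated on the stacked vector (a, b), with image (A a + B b, - B^T a).\<close>

lemma gaussian_channel_dilation:
  fixes A B :: "real^'m::finite^'m"
  assumes "gaussian_channel A B"
  shows "(norm (A *v a + B *v b))\<^sup>2 + (norm (transpose B *v a))\<^sup>2 \<le> (norm a)\<^sup>2 + (norm b)\<^sup>2"
proof -
  define join :: "real^'m \<Rightarrow> real^'m \<Rightarrow> real^('m + 'm)"
    where "join = (\<lambda>a b. \<chi> i. case i of Inl j \<Rightarrow> a $ j | Inr j \<Rightarrow> b $ j)"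
  have norm_join: "join a b \<bullet> join a b = (norm a)\<^sup>2 + (norm b)\<^sup>2" for a b
    by (simp add: join_def inner_vec_def sum_UNIV_sum_type power2_norm_eq_inner)
  let ?M = "channel_matrix A B"
  have "(?M *v join a b) $ i = join (A *v a + B *v b) (- (transpose B *v a)) $ i" for i
    by (cases i) (simp_all add: join_def channel_matrix_def block_matrix_def
        matrix_vector_mult_def sum_UNIV_sum_type sum_negf)
  then have M: "?M *v join a b = join (A *v a + B *v b) (- (transpose B *v a))"
    by (simp add: vec_eq_iff)
  have "0 \<le> join a b \<bullet> ((mat 1 - transpose ?M ** ?M) *v join a b)"
    using assms by (simp add: gaussian_channel_def loewner_le_def)
  also have "\<dots> = join a b \<bullet> join a b - (?M *v join a b) \<bullet> (?M *v join a b)"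
  proof -
    have "(transpose ?M *v (?M *v join a b)) \<bullet> join a b = (?M *v join a b) \<bullet> (?M *v join a b)"
      by (simp only: transpose_matrix_vector dot_lmul_matrix)
    then have "join a b \<bullet> (transpose ?M *v (?M *v join a b)) = (?M *v join a b) \<bullet> (?M *v join a b)"
      by (subst inner_commute)
    then show ?thesis
      by (simp only: matrix_vector_mult_diff_rdistrib inner_diff_right matrix_vector_mul_lid
          matrix_vector_mul_assoc[symmetric])
  qed
  finally show ?thesis by (simp add: M norm_join)
qed

text \<open>The complex form of the channel condition: the block matrix with rows (E, F) and (-
  F\<dagger>, 0) is a contraction.\<close>

definition dilation :: "complex^'m^'m::finite \<Rightarrow> complex^'m^'m \<Rightarrow> bool"
  where "dilation E F \<longleftrightarrow> (\<forall>a b.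
    (norm (E *v a + F *v b))\<^sup>2 + (norm (hermitian_adjoint F *v a))\<^sup>2 \<le> (norm a)\<^sup>2 + (norm b)\<^sup>2)"

text \<open>Real matrices act separately on real and imaginary parts, whose squared norms add, so
  two copies of the real inequality suffice.\<close>

lemma dilation_of_real:
  fixes A B :: "real^'m::finite^'m"
  assumes "gaussian_channel A B"
  shows "dilation (map_matrix of_real A) (map_matrix of_real B)"
proof -
  define re im :: "complex^'m \<Rightarrow> real^'m"
    where "re = (\<lambda>v. \<chi> i. Re (v $ i))" and "im = (\<lambda>v. \<chi> i. Im (v $ i))"
  have norm: "(norm v)\<^sup>2 = (norm (re v))\<^sup>2 + (norm (im v))\<^sup>2" for v
    by (simp add: re_def im_def power2_norm_eq_inner inner_vec_def inner_complex_def sum.distrib)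
  have reim: "re (map_matrix of_real M *v v) = M *v re v" "im (map_matrix of_real M *v v) = M *v im v"
    "re (v + w) = re v + re w" "im (v + w) = im v + im w" for M :: "real^'m^'m" and v w
    by (simp_all add: re_def im_def vec_eq_iff matrix_vector_mult_def)
  have adj: "hermitian_adjoint (map_matrix of_real B) = map_matrix of_real (transpose B)"
    by (simp add: hermitian_adjoint_def vec_eq_iff transpose_def)
  show ?thesis
    unfolding dilation_def adj norm reim
    using gaussian_channel_dilation[OF assms] by (smt (verit, best))
qed

lemma dilation_conjugate:
  fixes E F U :: "complex^'m::finite^'m"
  assumes EF: "dilation E F" and U: "hermitian_adjoint U ** U = mat 1" "U ** hermitian_adjoint U = mat 1"
  shows "dilation (U ** E ** hermitian_adjoint U) (U ** F ** hermitian_adjoint U)"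
proof -
  let ?H = "hermitian_adjoint U"
  have norm: "norm (W *v v) = norm v" if "hermitian_adjoint W ** W = mat 1" for W :: "complex^'m^'m" and v
  proof -
    have "(W *v v) \<bullet> (W *v v) = v \<bullet> v"
      using that inner_adjoint[of W "W *v v" v] by (simp add: matrix_vector_mul_assoc inner_commute)
    then show ?thesis by (simp add: norm_eq)
  qed
  show ?thesis
    unfolding dilation_def
  proof (intro allI)
    fix a b
    have "(U ** E ** ?H) *v a + (U ** F ** ?H) *v b = U *v (E *v (?H *v a) + F *v (?H *v b))"
      by (simp add: matrix_vector_right_distrib matrix_vector_mul_assoc matrix_mul_assoc)
    moreover have "hermitian_adjoint (U ** F ** ?H) *v a = U *v (hermitian_adjoint F *v (?H *v a))"
      by (simp add: hermitian_adjoint_mult matrix_vector_mul_assoc matrix_mul_assoc)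
    moreover have "norm (?H *v v) = norm v" for v
      by (rule norm) (simp add: U)
    ultimately show "(norm ((U ** E ** ?H) *v a + (U ** F ** ?H) *v b))\<^sup>2
        + (norm (hermitian_adjoint (U ** F ** ?H) *v a))\<^sup>2 \<le> (norm a)\<^sup>2 + (norm b)\<^sup>2"
      using EF[unfolded dilation_def, rule_format, of "?H *v a" "?H *v b"] U(1) by (simp add: norm)
  qed
qed

text \<open>Closing the second port of the contraction \<open>(a, b) \<mapsto> (E a + F b, - F\<^sup>\<dagger> a)\<close> with the
  contraction \<open>- X\<close> yields \<open>E + F X F\<^sup>\<dagger>\<close>.\<close>

lemma dilation_feedback:
  assumes EF: "dilation E F" and X: "contraction X"
  shows "contraction (E + F ** X ** hermitian_adjoint F)"
  unfolding contraction_def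
proof
  fix v
  let ?w = "hermitian_adjoint F *v v"
  have eq: "(E + F ** X ** hermitian_adjoint F) *v v = E *v v + F *v (X *v ?w)"
    by (simp add: matrix_vector_mult_add_rdistrib matrix_vector_mul_assoc matrix_mul_assoc)
  have "(norm (E *v v + F *v (X *v ?w)))\<^sup>2 + (norm ?w)\<^sup>2 \<le> (norm v)\<^sup>2 + (norm (X *v ?w))\<^sup>2"
    using EF by (simp add: dilation_def)
  moreover have "(norm (X *v ?w))\<^sup>2 \<le> (norm ?w)\<^sup>2"
    using X by (simp add: contraction_def power_mono)
  ultimately have "(norm ((E + F ** X ** hermitian_adjoint F) *v v))\<^sup>2 \<le> (norm v)\<^sup>2"
    unfolding eq by linarith
  then show "norm ((E + F ** X ** hermitian_adjoint F) *v v) \<le> norm v"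
    by (rule power2_le_imp_le) simp
qed

lemma dilation_contraction:
  assumes "dilation E F"
  shows "contraction F"
  unfolding contraction_def
proof
  fix b
  have "(norm (F *v b))\<^sup>2 \<le> (norm b)\<^sup>2"
    using assms[unfolded dilation_def, rule_format, of 0 b] by simp
  then show "norm (F *v b) \<le> norm b" by (rule power2_le_imp_le) simp
qed

lemma shift_matrix_unitary:
  fixes k :: real
  defines "U \<equiv> shift_matrix k :: complex^('n::finite + 'n)^('n + 'n)"
  shows "U ** hermitian_adjoint U = mat 1" "hermitian_adjoint U ** U = mat 1"
proof -
  have e: "exp (- (\<i> * complex_of_real k)) * cnj (exp (- (\<i> * complex_of_real k))) = 1"
    by (simp add: exp_cnj flip: exp_add)
  have "(U ** hermitian_adjoint U) $ i $ j = mat 1 $ i $ j" for i j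
    by (cases i; cases j)
       (auto simp: matrix_matrix_mult_def U_def shift_matrix_def block_matrix_def hermitian_adjoint_def
         transpose_def mat_def sum_UNIV_sum_type if_distrib[of cnj] if_distribR e
         if_distrib[of "\<lambda>x. _ * x"] if_distrib[of "\<lambda>x. x * _"] cong: if_cong)
  then show "U ** hermitian_adjoint U = mat 1" by (simp add: vec_eq_iff)
  then show "hermitian_adjoint U ** U = mat 1" using matrix_left_right_inverse by blast
qed

lemma momentum_even_transpose: "momentum_even (transpose M) k = hermitian_adjoint (momentum_even M k)"
proof -
  have "hermitian_adjoint (map_matrix of_real M) = map_matrix of_real (transpose M)"
    by (simp add: hermitian_adjoint_def vec_eq_iff transpose_def)
  then show ?thesis
    by (simp add: momentum_even_def hermitian_adjoint_mult matrix_mul_assoc)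
qed

text \<open>One period is the odd channel followed by the even one, so
  \<open>dilation_feedback\<close> is applied to \<open>X\<close> and then to the output of the odd
  step.\<close>

lemma contractive_pair_period:
  assumes "gaussian_channel Ao Bo" "gaussian_channel Ae Be"
  shows "contractive_pair (period_A Ao Ae Be k) (period_B Bo Be k)"
proof -
  let ?Ao = "map_matrix of_real Ao" and ?Bo = "map_matrix of_real Bo"
  let ?E = "momentum_even Ae k" and ?F = "momentum_even Be k"
  have o: "dilation ?Ao ?Bo" using assms(1) by (rule dilation_of_real)
  have e: "dilation ?E ?F"
    unfolding momentum_even_def
    by (intro dilation_conjugate dilation_of_real assms(2) shift_matrix_unitary)
  have "contraction (period_A Ao Ae Be k + period_B Bo Be k ** X ** hermitian_adjoint (period_B Bo Be k))"
    if "contraction X" for X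
  proof -
    have "period_A Ao Ae Be k + period_B Bo Be k ** X ** hermitian_adjoint (period_B Bo Be k)
        = ?E + ?F ** (?Ao + ?Bo ** X ** hermitian_adjoint ?Bo) ** hermitian_adjoint ?F"
      by (simp add: period_A_def period_B_def momentum_even_transpose hermitian_adjoint_mult
          matrix_add_ldistrib matrix_mult_add_distrib_right matrix_mul_assoc add.assoc)
    then show ?thesis
      using dilation_feedback[OF e dilation_feedback[OF o that]] by simp
  qed
  moreover have "contraction (period_B Bo Be k)"
    unfolding period_B_def using o e by (intro contraction_mult dilation_contraction)
  ultimately show ?thesis by (simp add: contractive_pair_def)
qed

section \<open>Rational steady state and decay of the correlations\<close>

lemma steady_state_momentum_rational:
  fixes Ao Bo Ae Be :: "real^('n::finite + 'n)^('n + 'n)"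
  assumes "gaussian_channel Ao Bo" "gaussian_channel Ae Be"
  obtains n d :: "('n + 'n) \<times> ('n + 'n) \<Rightarrow> complex poly" and Z
  where "finite Z" "\<And>p k. poly (d p) (cis k) \<noteq> 0"
    "\<And>k. cis k \<notin> Z \<Longrightarrow> steady_state_momentum Ao Bo Ae Be k
      = (\<chi> a b. poly (n (a, b)) (cis k) / poly (d (a, b)) (cis k))"
proof -
  let ?A = "period_A Ao Ae Be" and ?B = "period_B Bo Be"
  have AB: "contractive_pair (?A k) (?B k)" for k
    using assms by (rule contractive_pair_period)
  then have B: "contraction (?B k)" for k by (simp add: contractive_pair_def)
  define Q where "Q = (\<lambda>p n d Z. finite Z \<and> (\<forall>k. poly d (cis k) \<noteq> 0) \<and> (\<forall>k. cis k \<notin> Z \<longrightarrow>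
      ((\<lambda>r. damped_numerator (?A k) (?B k) p r / det (damped_system (?B k) r))
        \<longlongrightarrow> poly n (cis k) / poly d (cis k)) (at_left 1)))"
  have "\<exists>n d Z. Q p n d Z" for p
    unfolding Q_def
    by (intro trig_poly_quotient_limit trig_poly_damped_numerator trig_poly_det_damped_system
        trig_matrix_period_A trig_matrix_period_B det_damped_system_nonzero B damped_numerator_le AB)
  then obtain n d Z where Q: "\<And>p. Q p (n p) (d p) (Z p)" by metis
  then have Z: "\<And>p. finite (Z p)" and d: "\<And>p k. poly (d p) (cis k) \<noteq> 0" and
    lim: "\<And>p k. cis k \<notin> Z p \<Longrightarrow>
      ((\<lambda>r. damped_numerator (?A k) (?B k) p r / det (damped_system (?B k) r))
        \<longlongrightarrow> poly (n p) (cis k) / poly (d p) (cis k)) (at_left 1)"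
    unfolding Q_def by blast+
  show thesis
  proof (rule that[of "\<Union>p. Z p" d n])
    fix k assume "cis k \<notin> (\<Union>p. Z p)"
    then show "steady_state_momentum Ao Bo Ae Be k
        = (\<chi> a b. poly (n (a, b)) (cis k) / poly (d (a, b)) (cis k))"
      unfolding steady_state_momentum_def
      by (intro dissipative_steady_state_entry_limit AB lim) auto
  qed (use Z d in auto)
qed

text \<open>A crude bound that reduces the decay of the operator norm to that of single
  entries.\<close>

lemma onorm_matrix_le_sum:
  fixes M :: "complex^'n^'m"
  shows "onorm ((*v) M) \<le> (\<Sum>i\<in>UNIV. \<Sum>j\<in>UNIV. norm (M $ i $ j))"
proof (rule onorm_le)
  fix v
  have "norm (M *v v) \<le> (\<Sum>i\<in>UNIV. norm ((M *v v) $ i))"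
    unfolding norm_vec_def by (rule L2_set_le_sum) simp
  also have "\<dots> \<le> (\<Sum>i\<in>UNIV. \<Sum>j\<in>UNIV. norm (M $ i $ j) * norm v)"
  proof (rule sum_mono)
    fix i
    have "norm ((M *v v) $ i) \<le> (\<Sum>j\<in>UNIV. norm (M $ i $ j * v $ j))"
      unfolding matrix_vector_mult_def by (simp add: norm_sum)
    also have "\<dots> \<le> (\<Sum>j\<in>UNIV. norm (M $ i $ j) * norm v)"
      by (intro sum_mono) (simp add: norm_mult mult_left_mono Finite_Cartesian_Product.norm_nth_le)
    finally show "norm ((M *v v) $ i) \<le> (\<Sum>j\<in>UNIV. norm (M $ i $ j) * norm v)" .
  qed
  finally show "norm (M *v v) \<le> (\<Sum>i\<in>UNIV. \<Sum>j\<in>UNIV. norm (M $ i $ j)) * norm v"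
    by (simp add: sum_distrib_right)
qed

lemma finite_cis_vimage:
  assumes "finite Z"
  shows "finite {k \<in> {-pi..pi}. cis k \<in> Z}"
proof (rule finite_subset)
  \<comment> \<open>\<open>Arg\<close> inverts \<open>cis\<close> only on the half-open interval, so
    the endpoint \<open>-pi\<close> is added by hand.\<close>
  show "{k \<in> {-pi..pi}. cis k \<in> Z} \<subseteq> insert (-pi) (Arg ` Z)"
  proof
    fix k assume k: "k \<in> {k \<in> {-pi..pi}. cis k \<in> Z}"
    show "k \<in> insert (-pi) (Arg ` Z)"
    proof (cases "k = -pi")
      case False
      then have "Arg (cis k) = k" using k by (intro cis_Arg_unique) (auto simp: sgn_div_norm)
      then show ?thesis using k by force
    qed simp
  qed
qed (use assms in auto)

theorem corollary3p3:
  fixes Ao Bo Ae Be :: "real^('n::finite + 'n)^('n + 'n)"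
  assumes "gaussian_channel Ao Bo"
    and "gaussian_channel Ae Be"
  shows "(\<forall>x::int. set_integrable lborel {-pi..pi} (correlation_integrand Ao Bo Ae Be x)) \<and>
    (\<exists>C \<xi> :: real. C > 0 \<and> \<xi> > 0 \<and>
      (\<forall>x::int. onorm ((*v) (correlation Ao Bo Ae Be x)) \<le> C * exp (- \<bar>real_of_int x\<bar> / \<xi>)))"
proof -
  obtain n d :: "('n + 'n) \<times> ('n + 'n) \<Rightarrow> complex poly" and Z where
    Z: "finite Z" and d: "\<And>p k. poly (d p) (cis k) \<noteq> 0" and
    rational: "\<And>k. cis k \<notin> Z \<Longrightarrow> steady_state_momentum Ao Bo Ae Be k
      = (\<chi> a b. poly (n (a, b)) (cis k) / poly (d (a, b)) (cis k))"
    by (rule steady_state_momentum_rational[OF assms]) blast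
  define h where "h = (\<lambda>(x::int) p k. cis k powi x * (poly (n p) (cis k) / poly (d p) (cis k)))"
  \<comment> \<open>A continuous function equal to the integrand on the interval up to finitely many
    momenta; integrability and the integral are obtained from it.\<close>
  define g :: "int \<Rightarrow> real \<Rightarrow> complex^('n + 'n)^('n + 'n)"
    where "g = (\<lambda>x k. \<chi> a b. h x (a, b) k / of_real (2 * pi))"
  let ?X = "{k \<in> {-pi..pi}. cis k \<in> Z}"
  have X: "countable ?X" using finite_cis_vimage[OF Z] by (rule countable_finite)
  have e: "exp (\<i> * of_real k * of_int x) = cis k powi x" for k x
    unfolding cis_power_int unfolding cis_conv_exp by (simp add: mult_ac)
  have integrand: "indicator {-pi..pi} k *\<^sub>R correlation_integrand Ao Bo Ae Be x k
      = indicator {-pi..pi} k *\<^sub>R g x k" if "k \<notin> ?X" for x k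
  proof (cases "k \<in> {-pi..pi}")
    case True
    with that have "cis k \<notin> Z" by simp
    from rational[OF this] show ?thesis
      by (simp add: correlation_integrand_def g_def h_def vec_eq_iff e)
  qed simp
  have cont: "continuous_on {-pi..pi} (h x p)" for x p
    unfolding h_def using d by (intro continuous_intros) auto
  have int_h: "set_integrable lborel {-pi..pi} (h x p)" for x p
    by (intro borel_integrable_atLeastAtMost' cont)
  have "continuous_on {-pi..pi} (g x)" for x
    unfolding g_def using cont by (intro continuous_intros) auto
  then have int_g: "set_integrable lborel {-pi..pi} (g x)" for x
    by (rule borel_integrable_atLeastAtMost')
  have integrable: "set_integrable lborel {-pi..pi} (correlation_integrand Ao Bo Ae Be x)" for x
    using int_g[of x] unfolding set_integrable_def
    by (subst integrable_discrete_difference[OF X]) (use integrand in auto)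
  have "correlation Ao Bo Ae Be x = set_lebesgue_integral lborel {-pi..pi} (g x)" for x
    unfolding correlation_def set_lebesgue_integral_def
    by (rule integral_discrete_difference[OF X]) (use integrand in auto)
  moreover have "set_lebesgue_integral lborel {-pi..pi} (g x) $ a $ b
      = integral {-pi..pi} (h x (a, b)) / of_real (2 * pi)" for x a b
  proof -
    have bl: "bounded_linear (\<lambda>M :: complex^('n + 'n)^('n + 'n). M $ a $ b)"
      using bounded_linear_compose[OF bounded_linear_vec_nth[of b] bounded_linear_vec_nth[of a]] .
    have "set_lebesgue_integral lborel {-pi..pi} (g x) $ a $ b
        = set_lebesgue_integral lborel {-pi..pi} (\<lambda>k. h x (a, b) k / of_real (2 * pi))"
      unfolding set_lebesgue_integral_def
      using integral_bounded_linear[OF bl int_g[of x, unfolded set_integrable_def]]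
      by (simp add: g_def)
    also have "\<dots> = set_lebesgue_integral lborel {-pi..pi} (h x (a, b)) / of_real (2 * pi)"
      by (rule set_integral_divide_zero)
    also have "set_lebesgue_integral lborel {-pi..pi} (h x (a, b)) = integral {-pi..pi} (h x (a, b))"
      by (rule set_borel_integral_eq_integral[OF int_h])
    finally show ?thesis .
  qed
  ultimately have entry: "correlation Ao Bo Ae Be x $ a $ b
      = integral {-pi..pi} (h x (a, b)) / of_real (2 * pi)" for x a b
    by simp
  define Q where "Q = (\<lambda>p C \<xi>. C > 0 \<and> \<xi> > 0 \<and>
      (\<forall>x::int. norm (integral {-pi..pi} (h x p)) \<le> C * exp (- \<bar>real_of_int x\<bar> / \<xi>)))"
  have "\<exists>C \<xi>. Q p C \<xi>" for p
    unfolding Q_def h_def by (intro fourier_coefficient_decay d)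
  then obtain C \<xi> where Q: "\<And>p. Q p (C p) (\<xi> p)" by metis
  then have C: "\<And>p. C p > 0" and \<xi>: "\<And>p. \<xi> p > 0" and
    decay: "\<And>p x. norm (integral {-pi..pi} (h x p)) \<le> C p * exp (- \<bar>real_of_int x\<bar> / \<xi> p)"
    unfolding Q_def by blast+
  \<comment> \<open>The sum of the positive decay lengths dominates each of them and so serves all
    entries at once.\<close>
  define \<Xi> where "\<Xi> = (\<Sum>p\<in>UNIV. \<xi> p)"
  define K where "K = (\<Sum>a\<in>UNIV. \<Sum>b\<in>UNIV. C (a, b))"
  have \<Xi>: "\<xi> p \<le> \<Xi>" for p
    unfolding \<Xi>_def using \<xi> by (intro member_le_sum) (auto intro: less_imp_le)
  have "\<Xi> > 0" using \<Xi> \<xi> less_le_trans by blast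
  moreover have "K > 0" unfolding K_def by (intro sum_pos C) auto
  moreover have "onorm ((*v) (correlation Ao Bo Ae Be x)) \<le> K * exp (- \<bar>real_of_int x\<bar> / \<Xi>)" for x
  proof -
    have "norm (correlation Ao Bo Ae Be x $ a $ b) \<le> C (a, b) * exp (- \<bar>real_of_int x\<bar> / \<Xi>)" for a b
    proof -
      \<comment> \<open>The prefactor 1 / (2 \<pi>) is below 1 and is dropped.\<close>
      have "norm (correlation Ao Bo Ae Be x $ a $ b) \<le> norm (integral {-pi..pi} (h x (a, b))) / 1"
        unfolding entry norm_divide using pi_gt3 by (intro divide_left_mono) auto
      also have "\<dots> \<le> C (a, b) * exp (- \<bar>real_of_int x\<bar> / \<xi> (a, b))" using decay by simp
      also have "\<dots> \<le> C (a, b) * exp (- \<bar>real_of_int x\<bar> / \<Xi>)"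
        using C[of "(a, b)"] \<xi>[of "(a, b)"] \<Xi>[of "(a, b)"]
        by (intro mult_left_mono) (auto intro!: divide_left_mono)
      finally show ?thesis .
    qed
    then have "(\<Sum>a\<in>UNIV. \<Sum>b\<in>UNIV. norm (correlation Ao Bo Ae Be x $ a $ b))
        \<le> (\<Sum>a\<in>UNIV. \<Sum>b\<in>UNIV. C (a, b) * exp (- \<bar>real_of_int x\<bar> / \<Xi>))"
      by (intro sum_mono)
    also have "\<dots> = K * exp (- \<bar>real_of_int x\<bar> / \<Xi>)"
      by (simp add: K_def sum_distrib_right)
    finally show ?thesis using onorm_matrix_le_sum order_trans by blast
  qed
  ultimately show ?thesis using integrable by blast
qed

end
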